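(* Let $G$ be a countable group. For any factor representation $\pi$ of $G$, there is an irreducible unitary representation $\sigma$ of $G$ such that $\mathrm{Ker}(\sigma) = \mathrm{Ker}(\pi)$.
   Context: Countable means finite or countably infinite. Two unitary representations $\pi, \pi'$ of a group $G$ (in Hilbert spaces) are disjoint if there do not exist non-zero subrepresentations $\rho$ of $\pi$ and $\rho'$ of $\pi'$ which are equivalent. A unitary representation $\pi$ of $G$ is a factor representation if it cannot be decomposed as the direct sum of two disjoint (non-zero) subrepresentations; equivalently, the von Neumann algebra generated by $\pi(G)$ is a factor. *)

theory Defs
  imports
    "HOL-Algebra.Bij"
    "HOL-Algebra.Coset"
    "HOL-Analysis.Abstract_Metric_Spaces"
    "HOL-Library.Countable_Set"
    "HOL-Library.Function_Algebras"
begin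

section \<open>Complex Hilbert spaces\<close>

text \<open>
  The underlying set is a complex linear subspace of the type \<open>'h\<close>, with the addition of the type
  and an explicit scalar multiplication and inner product. Explicit carriers put a representation
  and its subrepresentations on the same footing. The inner product is linear in the first argument
  and is constrained only on the carrier.
\<close>

record 'h hilbert =
  hcarrier :: "'h set"
  hscale :: "complex \<Rightarrow> 'h \<Rightarrow> 'h"
  hinner :: "'h \<Rightarrow> 'h \<Rightarrow> complex"

definition hnorm :: "'h hilbert \<Rightarrow> 'h \<Rightarrow> real"
  where "hnorm H x = sqrt (Re (hinner H x x))"

text \<open>The value 0 off the carrier is needed because \<^locale>\<open>Metric_space\<close> asks for symmetry and
  non-negativity of the distance on the whole type.\<close>

definition hdist :: "('h::ab_group_add) hilbert \<Rightarrow> 'h \<Rightarrow> 'h \<Rightarrow> real"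
  where "hdist H x y = (if x \<in> hcarrier H \<and> y \<in> hcarrier H then hnorm H (x - y) else 0)"

locale pre_hilbert_space = vector_space "hscale H" for H :: "('h::ab_group_add) hilbert" +
  assumes subspace_hcarrier: "subspace (hcarrier H)"
    and hinner_add: "\<lbrakk>x \<in> hcarrier H; y \<in> hcarrier H; z \<in> hcarrier H\<rbrakk>
      \<Longrightarrow> hinner H (x + y) z = hinner H x z + hinner H y z"
    and hinner_scale: "\<lbrakk>x \<in> hcarrier H; y \<in> hcarrier H\<rbrakk>
      \<Longrightarrow> hinner H (hscale H c x) y = c * hinner H x y"
    and hinner_commute: "\<lbrakk>x \<in> hcarrier H; y \<in> hcarrier H\<rbrakk>
      \<Longrightarrow> hinner H x y = cnj (hinner H y x)"
    and hinner_nonneg: "x \<in> hcarrier H \<Longrightarrow> 0 \<le> Re (hinner H x x)"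
    and hinner_definite: "\<lbrakk>x \<in> hcarrier H; hinner H x x = 0\<rbrakk> \<Longrightarrow> x = 0"
begin

lemma hinner_self: "x \<in> hcarrier H \<Longrightarrow> hinner H x x = of_real (Re (hinner H x x))"
  by (metis hinner_commute Reals_cnj_iff of_real_Re)

lemma hinner_add_right:
  "\<lbrakk>x \<in> hcarrier H; y \<in> hcarrier H; z \<in> hcarrier H\<rbrakk>
    \<Longrightarrow> hinner H z (x + y) = hinner H z x + hinner H z y"
  by (metis complex_cnj_add hinner_add hinner_commute subspace_add subspace_hcarrier)

lemma hinner_scale_right:
  "\<lbrakk>x \<in> hcarrier H; y \<in> hcarrier H\<rbrakk> \<Longrightarrow> hinner H x (hscale H c y) = cnj c * hinner H x y"
  by (metis complex_cnj_mult hinner_commute hinner_scale subspace_hcarrier subspace_scale)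

lemma Re_hinner_add_self:
  assumes "x \<in> hcarrier H" "y \<in> hcarrier H"
  shows "Re (hinner H (x + y) (x + y))
    = Re (hinner H x x) + 2 * Re (hinner H x y) + Re (hinner H y y)"
proof -
  have "x + y \<in> hcarrier H" using assms subspace_add subspace_hcarrier by blast
  moreover have "Re (hinner H y x) = Re (hinner H x y)"
    using hinner_commute[OF assms] by simp
  ultimately show ?thesis using assms by (simp add: hinner_add hinner_add_right)
qed

lemma Re_hinner_Cauchy_Schwarz:
  assumes x: "x \<in> hcarrier H" and y: "y \<in> hcarrier H"
  shows "Re (hinner H x y) \<le> hnorm H x * hnorm H y"
proof (cases "y = 0")
  case True
  then have "hinner H x y = 0" using hinner_scale_right[OF x y, of 0] by simp
  then show ?thesis using x y by (simp add: hnorm_def hinner_nonneg)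
next
  case False
  define a b c where "a = Re (hinner H x x)" and "b = Re (hinner H x y)"
    and "c = Re (hinner H y y)"
  have "c \<noteq> 0" using False hinner_definite hinner_self y c_def by force
  then have "0 < c" using hinner_nonneg[OF y] c_def by simp
  define t where "t = - b / c"
  have ty: "hscale H (of_real t) y \<in> hcarrier H"
    using y subspace_scale subspace_hcarrier by blast
  have "0 \<le> Re (hinner H (x + hscale H (of_real t) y) (x + hscale H (of_real t) y))"
    using x ty subspace_add subspace_hcarrier hinner_nonneg by blast
  also have "\<dots> = a + 2 * t * b + t\<^sup>2 * c"
    using x y ty by (simp add: Re_hinner_add_self hinner_scale hinner_scale_right
        a_def b_def c_def power2_eq_square)
  also have "\<dots> = a - b\<^sup>2 / c"
    using \<open>c \<noteq> 0\<close> by (simp add: t_def field_simps power2_eq_square)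
  finally have "b\<^sup>2 \<le> a * c" using \<open>0 < c\<close> by (simp add: field_simps)
  then have "b \<le> sqrt (a * c)" by (rule real_le_rsqrt)
  then show ?thesis by (simp add: a_def b_def c_def hnorm_def real_sqrt_mult)
qed

lemma hnorm_triangle:
  assumes x: "x \<in> hcarrier H" and y: "y \<in> hcarrier H"
  shows "hnorm H (x + y) \<le> hnorm H x + hnorm H y"
proof -
  have "Re (hinner H (x + y) (x + y)) \<le> (hnorm H x + hnorm H y)\<^sup>2"
    using Re_hinner_Cauchy_Schwarz[OF x y] x y
    by (simp add: Re_hinner_add_self power2_sum) (simp add: hnorm_def hinner_nonneg)
  moreover have "0 \<le> hnorm H x + hnorm H y" using x y by (simp add: hnorm_def hinner_nonneg)
  ultimately show ?thesis unfolding hnorm_def[of H "x + y"] by (intro real_le_lsqrt)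
qed

sublocale Hdist: Metric_space "hcarrier H" "hdist H"
proof
  have diff: "x - y \<in> hcarrier H" if "x \<in> hcarrier H" "y \<in> hcarrier H" for x y
    using that subspace_diff subspace_hcarrier by blast
  show "0 \<le> hdist H x y" for x y
    by (simp add: hdist_def hnorm_def diff hinner_nonneg)
  show "hdist H x y = hdist H y x" for x y
  proof -
    have "hnorm H (- z) = hnorm H z" if "z \<in> hcarrier H" for z
      using that subspace_scale[OF subspace_hcarrier that, of "-1"]
        hinner_scale[of z _ "-1"] hinner_scale_right[of _ z "-1"]
      by (simp add: hnorm_def)
    from this[of "x - y"] show ?thesis by (simp add: hdist_def diff)
  qed
  show "hdist H x y = 0 \<longleftrightarrow> x = y" if "x \<in> hcarrier H" "y \<in> hcarrier H" for x y
  proof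
    assume "hdist H x y = 0"
    then have "Re (hinner H (x - y) (x - y)) = 0" using that by (simp add: hdist_def hnorm_def)
    then show "x = y"
      using hinner_definite[OF diff[OF that]] hinner_self[OF diff[OF that]] by simp
  next
    assume "x = y"
    then show "hdist H x y = 0"
      using that hinner_scale[of x x 0] hinner_scale[of 0 0 0] subspace_0[OF subspace_hcarrier]
      by (simp add: hdist_def hnorm_def)
  qed
  show "hdist H x z \<le> hdist H x y + hdist H y z"
    if "x \<in> hcarrier H" "y \<in> hcarrier H" "z \<in> hcarrier H" for x y z
    using hnorm_triangle[of "x - y" "y - z"] that by (simp add: hdist_def diff)
qed

end

locale hilbert_space = pre_hilbert_space +
  assumes mcomplete_hcarrier: "Hdist.mcomplete"

definition closed_subspace :: "('h::ab_group_add) hilbert \<Rightarrow> 'h set \<Rightarrow> bool"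
  where "closed_subspace H W \<longleftrightarrow>
    W \<subseteq> hcarrier H \<and> module.subspace (hscale H) W \<and>
    closedin (Metric_space.mtopology (hcarrier H) (hdist H)) W"

definition sub_hilbert :: "'h hilbert \<Rightarrow> 'h set \<Rightarrow> 'h hilbert"
  where "sub_hilbert H W = H\<lparr>hcarrier := W\<rparr>"


section \<open>Unitary representations\<close>

definition unitary_iso ::
    "('h::ab_group_add) hilbert \<Rightarrow> ('k::ab_group_add) hilbert \<Rightarrow> ('h \<Rightarrow> 'k) \<Rightarrow> bool"
  where "unitary_iso H K U \<longleftrightarrow>
    bij_betw U (hcarrier H) (hcarrier K) \<and>
    (\<forall>x\<in>hcarrier H. \<forall>y\<in>hcarrier H. U (x + y) = U x + U y) \<and>
    (\<forall>c. \<forall>x\<in>hcarrier H. U (hscale H c x) = hscale K c (U x)) \<and>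
    (\<forall>x\<in>hcarrier H. \<forall>y\<in>hcarrier H. hinner K (U x) (U y) = hinner H x y)"

definition unitary_group :: "('h::ab_group_add) hilbert \<Rightarrow> ('h \<Rightarrow> 'h) monoid"
  where "unitary_group H =
    (BijGroup (hcarrier H))\<lparr>carrier := {U \<in> extensional (hcarrier H). unitary_iso H H U}\<rparr>"

lemma subgroup_unitary:
  assumes "hilbert_space H"
  shows "subgroup (carrier (unitary_group H)) (BijGroup (hcarrier H))"
proof -
  interpret hilbert_space H by fact
  interpret B: group "BijGroup (hcarrier H)" by (rule group_BijGroup)
  let ?S = "hcarrier H"
  let ?C = "carrier (unitary_group H)"
  have C: "U \<in> ?C \<longleftrightarrow> U \<in> extensional ?S \<and> unitary_iso H H U" for U
    by (simp add: unitary_group_def)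
  have Cbij: "U \<in> Bij ?S" if "U \<in> ?C" for U
    using that by (simp add: C Bij_def unitary_iso_def)
  note closed = subspace_add[OF subspace_hcarrier] subspace_scale[OF subspace_hcarrier]
  show ?thesis
  proof (rule B.subgroupI)
    show "?C \<subseteq> carrier (BijGroup ?S)" using Cbij by (auto simp: BijGroup_def)
    have "restrict (\<lambda>x. x) ?S \<in> ?C"
      using closed by (auto simp: C unitary_iso_def bij_betw_def inj_on_def)
    then show "?C \<noteq> {}" by blast
  next
    fix U assume U: "U \<in> ?C"
    let ?V = "inv_into ?S U"
    have b: "bij_betw U ?S ?S" using U by (simp add: C unitary_iso_def)
    have UV: "U (?V x) = x" "?V x \<in> ?S" if "x \<in> ?S" for x
      using b that by (auto simp: bij_betw_def inv_into_into f_inv_into_f)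
    have VU: "?V (U x) = x" "U x \<in> ?S" if "x \<in> ?S" for x
      using b that by (auto simp: bij_betw_def)
    have "unitary_iso H H (restrict ?V ?S)"
      unfolding unitary_iso_def
    proof (intro conjI ballI allI)
      show "bij_betw (restrict ?V ?S) ?S ?S" using b by (simp add: bij_betw_inv_into)
    next
      fix x y assume x: "x \<in> ?S" and y: "y \<in> ?S"
      have "U (?V x + ?V y) = x + y" using U x y UV by (simp add: C unitary_iso_def)
      then have "?V (x + y) = ?V x + ?V y" using VU UV x y closed by metis
      then show "restrict ?V ?S (x + y) = restrict ?V ?S x + restrict ?V ?S y"
        using x y closed by simp
      have "hinner H (U (?V x)) (U (?V y)) = hinner H (?V x) (?V y)"
        using U UV(2)[OF x] UV(2)[OF y] unfolding C unitary_iso_def by blast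
      then show "hinner H (restrict ?V ?S x) (restrict ?V ?S y) = hinner H x y"
        using x y UV by simp
    next
      fix c x assume x: "x \<in> ?S"
      have "U (hscale H c (?V x)) = hscale H c x" using U x UV by (simp add: C unitary_iso_def)
      then have "?V (hscale H c x) = hscale H c (?V x)" using VU UV x closed by metis
      then show "restrict ?V ?S (hscale H c x) = hscale H c (restrict ?V ?S x)"
        using x closed by simp
    qed
    then show "inv\<^bsub>BijGroup ?S\<^esub> U \<in> ?C"
      using Cbij[OF U] by (simp add: inv_BijGroup C)
  next
    fix U V assume UV: "U \<in> ?C" "V \<in> ?C"
    have m: "V x \<in> ?S" if "x \<in> ?S" for x
      using UV that by (auto simp: C unitary_iso_def bij_betw_def)
    have b: "bij_betw (compose ?S U V) ?S ?S"
      using compose_Bij[OF Cbij[OF UV(1)] Cbij[OF UV(2)]] by (simp add: Bij_def)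
    have "unitary_iso H H (compose ?S U V)"
      unfolding unitary_iso_def
      using UV m closed b by (auto simp: C unitary_iso_def compose_def)
    then show "U \<otimes>\<^bsub>BijGroup ?S\<^esub> V \<in> ?C"
      using Cbij UV by (simp add: BijGroup_def C)
  qed
qed

lemma group_unitary_group: "hilbert_space H \<Longrightarrow> group (unitary_group H)"
  using group.subgroup_imp_group[OF group_BijGroup subgroup_unitary]
  by (simp add: unitary_group_def)

definition unitary_rep ::
    "('g, 'm) monoid_scheme \<Rightarrow> ('h::ab_group_add) hilbert \<Rightarrow> ('g \<Rightarrow> 'h \<Rightarrow> 'h) \<Rightarrow> bool"
  where "unitary_rep G H \<pi> \<longleftrightarrow> hilbert_space H \<and> \<pi> \<in> hom G (unitary_group H)"

abbreviation rep_kernel ::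
    "('g, 'm) monoid_scheme \<Rightarrow> ('h::ab_group_add) hilbert \<Rightarrow> ('g \<Rightarrow> 'h \<Rightarrow> 'h) \<Rightarrow> 'g set"
  where "rep_kernel G H \<pi> \<equiv> kernel G (unitary_group H) \<pi>"

text \<open>A subrepresentation is given by the closed invariant subspace \<open>W\<close> that carries it; it is
  then the representation \<open>sub_rep \<pi> W\<close> in \<open>sub_hilbert H W\<close>.\<close>

definition invariant_closed_subspace ::
    "('g, 'm) monoid_scheme \<Rightarrow> ('h::ab_group_add) hilbert \<Rightarrow> ('g \<Rightarrow> 'h \<Rightarrow> 'h) \<Rightarrow> 'h set \<Rightarrow> bool"
  where "invariant_closed_subspace G H \<pi> W \<longleftrightarrow>
    closed_subspace H W \<and> (\<forall>g\<in>carrier G. \<forall>x\<in>W. \<pi> g x \<in> W)"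

definition sub_rep :: "('g \<Rightarrow> 'h \<Rightarrow> 'h) \<Rightarrow> 'h set \<Rightarrow> 'g \<Rightarrow> 'h \<Rightarrow> 'h"
  where "sub_rep \<pi> W = (\<lambda>g. restrict (\<pi> g) W)"

definition irreducible_rep ::
    "('g, 'm) monoid_scheme \<Rightarrow> ('h::ab_group_add) hilbert \<Rightarrow> ('g \<Rightarrow> 'h \<Rightarrow> 'h) \<Rightarrow> bool"
  where "irreducible_rep G H \<pi> \<longleftrightarrow>
    unitary_rep G H \<pi> \<and> hcarrier H \<noteq> {0} \<and>
    (\<forall>W. invariant_closed_subspace G H \<pi> W \<longrightarrow> W = {0} \<or> W = hcarrier H)"

definition equivalent_reps ::
    "('g, 'm) monoid_scheme \<Rightarrow> ('h::ab_group_add) hilbert \<Rightarrow> ('g \<Rightarrow> 'h \<Rightarrow> 'h) \<Rightarrow>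
      ('k::ab_group_add) hilbert \<Rightarrow> ('g \<Rightarrow> 'k \<Rightarrow> 'k) \<Rightarrow> bool"
  where "equivalent_reps G H \<pi> K \<rho> \<longleftrightarrow>
    (\<exists>U. unitary_iso H K U \<and> (\<forall>g\<in>carrier G. \<forall>x\<in>hcarrier H. U (\<pi> g x) = \<rho> g (U x)))"

definition disjoint_reps ::
    "('g, 'm) monoid_scheme \<Rightarrow> ('h::ab_group_add) hilbert \<Rightarrow> ('g \<Rightarrow> 'h \<Rightarrow> 'h) \<Rightarrow>
      ('k::ab_group_add) hilbert \<Rightarrow> ('g \<Rightarrow> 'k \<Rightarrow> 'k) \<Rightarrow> bool"
  where "disjoint_reps G H \<pi> K \<rho> \<longleftrightarrow>
    \<not> (\<exists>V W. invariant_closed_subspace G H \<pi> V \<and> V \<noteq> {0} \<and>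
      invariant_closed_subspace G K \<rho> W \<and> W \<noteq> {0} \<and>
      equivalent_reps G (sub_hilbert H V) (sub_rep \<pi> V) (sub_hilbert K W) (sub_rep \<rho> W))"

definition orthogonal_direct_sum :: "('h::ab_group_add) hilbert \<Rightarrow> 'h set \<Rightarrow> 'h set \<Rightarrow> bool"
  where "orthogonal_direct_sum H V W \<longleftrightarrow>
    (\<forall>x\<in>V. \<forall>y\<in>W. hinner H x y = 0) \<and> (\<forall>z\<in>hcarrier H. \<exists>x\<in>V. \<exists>y\<in>W. z = x + y)"

text \<open>The zero representation is not excluded here; it is excluded in \<^const>\<open>irreducible_rep\<close>.\<close>

definition factor_rep ::
    "('g, 'm) monoid_scheme \<Rightarrow> ('h::ab_group_add) hilbert \<Rightarrow> ('g \<Rightarrow> 'h \<Rightarrow> 'h) \<Rightarrow> bool"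
  where "factor_rep G H \<pi> \<longleftrightarrow>
    unitary_rep G H \<pi> \<and>
    \<not> (\<exists>V W. invariant_closed_subspace G H \<pi> V \<and> V \<noteq> {0} \<and>
      invariant_closed_subspace G H \<pi> W \<and> W \<noteq> {0} \<and>
      orthogonal_direct_sum H V W \<and>
      disjoint_reps G (sub_hilbert H V) (sub_rep \<pi> V) (sub_hilbert H W) (sub_rep \<pi> W))"

text \<open>
  An existence claim for a representation has to name the type of its vectors. Every non-zero
  irreducible representation \<open>\<rho>\<close> of \<open>G\<close> in a Hilbert space \<open>K\<close> is equivalent to one on a space of
  functions on \<open>G\<close>: for a fixed non-zero \<open>e\<close> in \<open>K\<close>, the map sending \<open>x\<close> to the function
  \<open>g \<mapsto> \<langle>x, \<rho>(g) e\<rangle>\<close> (and 0 off \<open>carrier G\<close>) is linear and injective, so \<open>K\<close> and \<open>\<rho>\<close> can be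
  transported along it. Hence the type \<open>('g \<Rightarrow> complex) hilbert\<close> loses no irreducible
  representation.
\<close>

end

theory Submission
  imports Defs "HOL-Analysis.Uniform_Limit"
begin

text \<open>
  For a normal subgroup \<open>N\<close> of \<open>G\<close>, the space \<open>H\<^sup>N\<close> of \<open>N\<close>-fixed vectors and its orthogonal
  complement are disjoint, so if \<open>\<pi>\<close> is a factor representation then \<open>H\<^sup>N = 0\<close> unless
  \<open>N \<subseteq> Ker \<pi>\<close>. Let \<open>\<phi>\<close> be a coefficient \<open>g \<mapsto> \<langle>\<pi>(g)\<xi>, \<xi>\<rangle>\<close> with \<open>\<xi>\<close> a unit vector, and for \<open>g\<close>
  outside \<open>Ker \<pi>\<close> let \<open>N\<close> be the normal closure of \<open>g\<close>. Since \<open>H\<^sup>N = 0\<close>, there are convex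
  combinations \<open>c\<close> of elements of \<open>N\<close> with \<open>\<phi>(c\<^sup>* c) = \<parallel>\<pi>(c)\<xi>\<parallel>\<^sup>2\<close> arbitrarily small, whereas
  \<open>\<psi>(c\<^sup>* c) = 1\<close> for every normalised positive definite function \<open>\<psi>\<close> whose
  Gelfand-Naimark-Segal representation is trivial at \<open>g\<close>. As \<open>G\<close> is countable, the \<open>c\<^sub>g\<close> can be
  chosen with \<open>\<Sum>\<^sub>g \<phi>(c\<^sub>g\<^sup>* c\<^sub>g) \<le> 1/2\<close>. The function \<open>\<psi> \<mapsto> \<Sum>\<^sub>g \<psi>(c\<^sub>g\<^sup>* c\<^sub>g)\<close> is affine and lower
  semicontinuous on the compact convex set of normalised positive definite functions equal to 1
  on \<open>Ker \<pi>\<close>, so it attains its minimum at an extreme point \<open>\<psi>\<close>. The representation of \<open>\<psi>\<close> is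
  irreducible by extremality, and its kernel is exactly \<open>Ker \<pi>\<close> because the minimum is less
  than 1.
\<close>

section \<open>Geometry of Hilbert spaces\<close>

lemma hcarrier_sub_hilbert [simp]: "hcarrier (sub_hilbert H W) = W"
  and hscale_sub_hilbert [simp]: "hscale (sub_hilbert H W) = hscale H"
  by (simp_all add: sub_hilbert_def)

text \<open>Near 0 the linear term dominates: at \<open>t = - b / s\<close> the value is negative
  unless \<open>b = 0\<close>. This serves as the first-order condition at a minimiser.\<close>

lemma real_quadratic_nonneg_imp_0:
  fixes b c :: real
  assumes "\<And>t. 0 \<le> 2 * t * b + t\<^sup>2 * c"
  shows "b = 0"
proof (rule ccontr)
  assume "b \<noteq> 0"
  define s where "s = \<bar>c\<bar> + 1"
  have s: "0 < s" "c < s" by (auto simp: s_def)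
  have "0 \<le> 2 * (- b / s) * b + (- b / s)\<^sup>2 * c" by (rule assms)
  also have "\<dots> = (b\<^sup>2 / s) * (c / s - 2)"
    using s by (simp add: field_simps power2_eq_square)
  also have "\<dots> < 0"
    using s \<open>b \<noteq> 0\<close> by (intro mult_pos_neg) (auto simp: field_simps)
  finally show False by simp
qed

section \<open>Inner product and norm identities\<close>

context pre_hilbert_space
begin

lemmas hcarrier_0 [simp] = subspace_0[OF subspace_hcarrier]
lemmas hcarrier_add [simp] = subspace_add[OF subspace_hcarrier]
lemmas hcarrier_diff [simp] = subspace_diff[OF subspace_hcarrier]
lemmas hcarrier_scale [simp] = subspace_scale[OF subspace_hcarrier]
lemmas hcarrier_sum = subspace_sum[OF subspace_hcarrier]

lemma hinner_0_left [simp]: "y \<in> hcarrier H \<Longrightarrow> hinner H 0 y = 0"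
  using hinner_scale[of 0 y 0] by simp

lemma hinner_0_right [simp]: "y \<in> hcarrier H \<Longrightarrow> hinner H y 0 = 0"
  using hinner_scale_right[of y 0 0] by simp

lemma hinner_diff_left:
  assumes "x \<in> hcarrier H" "y \<in> hcarrier H" "z \<in> hcarrier H"
  shows "hinner H (x - y) z = hinner H x z - hinner H y z"
  using hinner_add[of "x - y" y z] assms by simp

lemma hinner_diff_right:
  assumes "x \<in> hcarrier H" "y \<in> hcarrier H" "z \<in> hcarrier H"
  shows "hinner H z (x - y) = hinner H z x - hinner H z y"
  using hinner_add_right[of "x - y" y z] assms by simp

lemma hinner_sum_left:
  assumes "\<And>i. i \<in> S \<Longrightarrow> f i \<in> hcarrier H" "y \<in> hcarrier H"
  shows "hinner H (\<Sum>i\<in>S. f i) y = (\<Sum>i\<in>S. hinner H (f i) y)"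
  using assms
proof (induction S rule: infinite_finite_induct)
  case (insert i S)
  then have "(\<Sum>i\<in>S. f i) \<in> hcarrier H" by (intro hcarrier_sum) auto
  with insert show ?case by (simp add: hinner_add)
qed auto

lemma hinner_sum_right:
  assumes "\<And>i. i \<in> S \<Longrightarrow> f i \<in> hcarrier H" "y \<in> hcarrier H"
  shows "hinner H y (\<Sum>i\<in>S. f i) = (\<Sum>i\<in>S. hinner H y (f i))"
  using assms
proof (induction S rule: infinite_finite_induct)
  case (insert i S)
  then have "(\<Sum>i\<in>S. f i) \<in> hcarrier H" by (intro hcarrier_sum) auto
  with insert show ?case by (simp add: hinner_add_right)
qed auto

lemma hnorm_nonneg [simp]: "x \<in> hcarrier H \<Longrightarrow> 0 \<le> hnorm H x"
  by (simp add: hnorm_def hinner_nonneg)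

lemma hnorm_power2: "x \<in> hcarrier H \<Longrightarrow> (hnorm H x)\<^sup>2 = Re (hinner H x x)"
  by (simp add: hnorm_def hinner_nonneg)

lemma hinner_self_hnorm: "x \<in> hcarrier H \<Longrightarrow> hinner H x x = of_real ((hnorm H x)\<^sup>2)"
  using hinner_self hnorm_power2 by simp

lemma hnorm_0 [simp]: "hnorm H 0 = 0"
  by (simp add: hnorm_def)

lemma hnorm_eq_0_iff: "x \<in> hcarrier H \<Longrightarrow> hnorm H x = 0 \<longleftrightarrow> x = 0"
  using hinner_definite hinner_self_hnorm[of x] by auto

lemma hnorm_scale: "x \<in> hcarrier H \<Longrightarrow> hnorm H (hscale H c x) = cmod c * hnorm H x"
proof -
  assume x: "x \<in> hcarrier H"
  then have "hinner H (hscale H c x) (hscale H c x) = (c * cnj c) * hinner H x x"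
    by (simp add: hinner_scale hinner_scale_right)
  also have "\<dots> = of_real ((cmod c * hnorm H x)\<^sup>2)"
    using x by (simp add: hinner_self_hnorm complex_norm_square[symmetric] power_mult_distrib)
  finally have "(hnorm H (hscale H c x))\<^sup>2 = (cmod c * hnorm H x)\<^sup>2"
    using x by (simp add: hnorm_power2)
  then show ?thesis using x by (simp add: power2_eq_iff_nonneg)
qed

lemma hnorm_diff_commute:
  assumes "x \<in> hcarrier H" "y \<in> hcarrier H"
  shows "hnorm H (x - y) = hnorm H (y - x)"
  using Hdist.commute[of x y] assms by (simp add: hdist_def)

lemma Re_hinner_diff_self:
  assumes "x \<in> hcarrier H" "y \<in> hcarrier H"
  shows "(hnorm H (x - y))\<^sup>2 = (hnorm H x)\<^sup>2 - 2 * Re (hinner H x y) + (hnorm H y)\<^sup>2"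
proof -
  have "Re (hinner H y x) = Re (hinner H x y)" using hinner_commute[OF assms] by simp
  then show ?thesis
    using assms by (simp add: hnorm_power2 hinner_diff_left hinner_diff_right)
qed

lemma hnorm_add_power2:
  assumes "x \<in> hcarrier H" "y \<in> hcarrier H"
  shows "(hnorm H (x + y))\<^sup>2 = (hnorm H x)\<^sup>2 + 2 * Re (hinner H x y) + (hnorm H y)\<^sup>2"
  using Re_hinner_add_self[OF assms] assms by (simp add: hnorm_power2)

text \<open>Stated with the midpoint, because a lower bound on the norms of midpoints is what
  convexity supplies at a minimum.\<close>

lemma parallelogram:
  assumes "x \<in> hcarrier H" "y \<in> hcarrier H"
  shows "(hnorm H (x - y))\<^sup>2
    = 2 * (hnorm H x)\<^sup>2 + 2 * (hnorm H y)\<^sup>2 - 4 * (hnorm H (hscale H (1/2) (x + y)))\<^sup>2"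
proof -
  have half: "hnorm H (hscale H (1/2) (x + y)) = hnorm H (x + y) / 2"
    using assms by (simp add: hnorm_scale)
  show ?thesis
    unfolding half using assms by (simp add: Re_hinner_diff_self hnorm_add_power2 power_divide add_divide_distrib)
qed

text \<open>The unimodular factor \<open>u\<close> rotates \<open>hinner H x y\<close> onto the
  positive real axis, which reduces the claim to \<open>Re_hinner_Cauchy_Schwarz\<close>.\<close>

lemma Cauchy_Schwarz:
  assumes x: "x \<in> hcarrier H" and y: "y \<in> hcarrier H"
  shows "cmod (hinner H x y) \<le> hnorm H x * hnorm H y"
proof (cases "hinner H x y = 0")
  case True
  with x y show ?thesis by simp
next
  case False
  define u where "u = cnj (sgn (hinner H x y))"
  have u: "cmod u = 1" using False by (simp add: u_def norm_sgn)
  have "u * hinner H x y = cmod (hinner H x y)"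
    using complex_norm_square[of "hinner H x y"] False
    by (simp add: u_def sgn_div_norm scaleR_conv_of_real field_simps power2_eq_square)
  then have "Re (hinner H (hscale H u x) y) = cmod (hinner H x y)"
    using x y by (simp add: hinner_scale)
  then show ?thesis
    using Re_hinner_Cauchy_Schwarz[of "hscale H u x" y] x y u by (simp add: hnorm_scale)
qed

text \<open>Upgrades facts about real parts to complex ones, by applying them to
  \<open>hscale H \<i> y\<close> as well as to \<open>y\<close>.\<close>

lemma hinner_imaginary_part:
  assumes "x \<in> hcarrier H" "y \<in> hcarrier H"
  shows "Im (hinner H x y) = Re (hinner H x (hscale H \<i> y))"
  using assms by (simp add: hinner_scale_right)

section \<open>Limits of sequences and closed subspaces\<close>

definition hlim :: "(nat \<Rightarrow> 'h) \<Rightarrow> 'h \<Rightarrow> bool"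
  where "hlim X x \<longleftrightarrow> range X \<subseteq> hcarrier H \<and> x \<in> hcarrier H \<and> (\<lambda>n. hnorm H (X n - x)) \<longlonglongrightarrow> 0"

text \<open>The bridge to the metric topology in the definitions of closed subspace and
  completeness; everything afterwards is argued with sequences.\<close>

lemma hlim_iff_limitin:
  assumes "range X \<subseteq> hcarrier H"
  shows "hlim X x \<longleftrightarrow> limitin Hdist.mtopology X x sequentially"
proof -
  have "hdist H (X n) x = hnorm H (X n - x)" if "x \<in> hcarrier H" for n
    using assms that by (auto simp: hdist_def)
  then show ?thesis
    using assms unfolding hlim_def Hdist.limitin_metric_dist_null by (auto simp: image_subset_iff)
qed

lemma hlim_hinner:
  assumes X: "hlim X x" and y: "y \<in> hcarrier H"
  shows "(\<lambda>n. hinner H (X n) y) \<longlonglongrightarrow> hinner H x y"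
proof -
  have mem: "X n \<in> hcarrier H" "x \<in> hcarrier H" for n using X by (auto simp: hlim_def)
  have "(\<lambda>n. hnorm H (X n - x) * hnorm H y) \<longlonglongrightarrow> 0"
    using X by (auto simp: hlim_def intro: tendsto_mult_left_zero)
  then have "(\<lambda>n. hinner H (X n) y - hinner H x y) \<longlonglongrightarrow> 0"
  proof (rule Lim_null_comparison[rotated])
    show "\<forall>\<^sub>F n in sequentially. norm (hinner H (X n) y - hinner H x y)
        \<le> hnorm H (X n - x) * hnorm H y"
      using Cauchy_Schwarz mem y by (auto simp: hinner_diff_left[symmetric])
  qed
  then show ?thesis by (rule LIM_zero_cancel)
qed

lemma hlim_unique:
  assumes "hlim X x" "hlim X y"
  shows "x = y"
proof -
  have "range X \<subseteq> hcarrier H" using assms by (simp add: hlim_def)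
  with assms show ?thesis
    using Hdist.limitin_metric_unique trivial_limit_sequentially by (metis hlim_iff_limitin)
qed

lemma closed_subspaceI:
  assumes "W \<subseteq> hcarrier H" "subspace W"
    and "\<And>X x. range X \<subseteq> W \<Longrightarrow> hlim X x \<Longrightarrow> x \<in> W"
  shows "closed_subspace H W"
  unfolding closed_subspace_def Hdist.metric_closedin_iff_sequentially_closed
proof (intro conjI allI impI)
  fix X x assume *: "range X \<subseteq> W \<and> limitin Hdist.mtopology X x sequentially"
  then have "range X \<subseteq> hcarrier H" using assms(1) by blast
  then show "x \<in> W" using * assms(3) hlim_iff_limitin by blast
qed (use assms in auto)

lemma closed_subspaceD:
  assumes "closed_subspace H W"
  shows "W \<subseteq> hcarrier H" "subspace W"
    and "range X \<subseteq> W \<Longrightarrow> hlim X x \<Longrightarrow> x \<in> W"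
proof -
  show *: "W \<subseteq> hcarrier H" "subspace W" using assms by (auto simp: closed_subspace_def)
  assume X: "range X \<subseteq> W" "hlim X x"
  then have "limitin Hdist.mtopology X x sequentially"
    using hlim_iff_limitin * by blast
  with X(1) assms show "x \<in> W"
    unfolding closed_subspace_def Hdist.metric_closedin_iff_sequentially_closed by blast
qed

section \<open>Orthogonal complements\<close>

definition horth :: "'h set \<Rightarrow> 'h set"
  where "horth W = {y \<in> hcarrier H. \<forall>x\<in>W. hinner H y x = 0}"

lemma closed_subspace_horth:
  assumes W: "W \<subseteq> hcarrier H"
  shows "closed_subspace H (horth W)"
proof (rule closed_subspaceI)
  show "horth W \<subseteq> hcarrier H" by (auto simp: horth_def)
  show "subspace (horth W)"
    using W by (auto simp: subspace_def horth_def hinner_add hinner_scale subset_iff)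
next
  fix X y assume X: "range X \<subseteq> horth W" "hlim X y"
  have "hinner H y x = 0" if "x \<in> W" for x
  proof -
    have "(\<lambda>n. hinner H (X n) x) \<longlonglongrightarrow> hinner H y x" using X W that hlim_hinner by blast
    moreover have "(\<lambda>n. hinner H (X n) x) = (\<lambda>n. 0)"
      using X(1) that by (auto simp: horth_def)
    ultimately show ?thesis by (simp add: LIMSEQ_const_iff)
  qed
  then show "y \<in> horth W" using X(2) by (simp add: horth_def hlim_def)
qed

lemma horth_swap:
  assumes "y \<in> horth W" "x \<in> W" "W \<subseteq> hcarrier H"
  shows "hinner H x y = 0"
  using assms hinner_commute[of x y] by (auto simp: horth_def)

lemma disjoint_horth:
  assumes "x \<in> W" "x \<in> horth W"
  shows "x = 0"
  using assms hinner_definite by (auto simp: horth_def)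

text \<open>Two vectors of nearly minimal norm are close to each other. This makes minimising
  sequences Cauchy, and later makes them almost invariant under isometries that preserve the convex
  set.\<close>

lemma minimizing_diff:
  assumes "x \<in> hcarrier H" "y \<in> hcarrier H" "m \<le> (hnorm H (hscale H (1/2) (x + y)))\<^sup>2"
  shows "(hnorm H (x - y))\<^sup>2 \<le> 2 * ((hnorm H x)\<^sup>2 - m) + 2 * ((hnorm H y)\<^sup>2 - m)"
  using parallelogram[OF assms(1,2)] assms(3) by simp

end

section \<open>Completeness, minimising sequences and projections\<close>

context hilbert_space
begin

lemma hlim_Cauchy:
  assumes X: "range X \<subseteq> hcarrier H"
    and C: "\<And>e. 0 < e \<Longrightarrow> \<exists>N. \<forall>n\<ge>N. \<forall>k\<ge>N. hnorm H (X n - X k) < e"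
  obtains x where "hlim X x"
proof -
  have "hdist H (X n) (X k) = hnorm H (X n - X k)" for n k
    using X by (auto simp: hdist_def)
  then have "Hdist.MCauchy X"
    unfolding Hdist.MCauchy_def using X C by auto
  then show ?thesis
    using mcomplete_hcarrier hlim_iff_limitin[OF X] that unfolding Hdist.mcomplete_def by blast
qed

text \<open>The midpoint hypothesis stands in for convexity of the set through which the sequence
  runs; it is met both by translates of a subspace and by orbit hulls.\<close>

lemma minimizing_sequence:
  assumes X: "range X \<subseteq> hcarrier H" and lim: "(\<lambda>n. (hnorm H (X n))\<^sup>2) \<longlonglongrightarrow> m"
    and mid: "\<And>n k. m \<le> (hnorm H (hscale H (1/2) (X n + X k)))\<^sup>2"
  obtains x where "hlim X x"
proof -
  have X': "X n \<in> hcarrier H" for n using X by auto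
  show ?thesis
  proof (rule hlim_Cauchy[OF X])
    fix e :: real assume e: "0 < e"
    \<comment> \<open>With this tolerance the bound of \<open>minimizing_diff\<close> adds up to
      \<open>2 * (e^2 / 4) + 2 * (e^2 / 4) = e^2\<close>.\<close>
    then have "0 < e\<^sup>2 / 4" by simp
    with lim obtain N where N: "\<And>n. n \<ge> N \<Longrightarrow> dist ((hnorm H (X n))\<^sup>2) m < e\<^sup>2 / 4"
      unfolding LIMSEQ_def by blast
    have "hnorm H (X n - X k) < e" if "n \<ge> N" "k \<ge> N" for n k
    proof -
      have "(hnorm H (X n))\<^sup>2 - m < e\<^sup>2 / 4" "(hnorm H (X k))\<^sup>2 - m < e\<^sup>2 / 4"
        using N[OF that(1)] N[OF that(2)] unfolding dist_real_def by linarith+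
      then have "2 * ((hnorm H (X n))\<^sup>2 - m) + 2 * ((hnorm H (X k))\<^sup>2 - m)
          < 2 * (e\<^sup>2 / 4) + 2 * (e\<^sup>2 / 4)"
        by (intro add_strict_mono mult_strict_left_mono) auto
      then have "(hnorm H (X n - X k))\<^sup>2 < e\<^sup>2"
        using minimizing_diff[OF X'[of n] X'[of k] mid[of n k]] by simp
      then show ?thesis using e by (meson less_eq_real_def power_less_imp_less_base)
    qed
    then show "\<exists>N. \<forall>n\<ge>N. \<forall>k\<ge>N. hnorm H (X n - X k) < e" by blast
  qed (use that in blast)
qed

lemma hlim_hnorm:
  assumes "hlim X x"
  shows "(\<lambda>n. hnorm H (X n)) \<longlonglongrightarrow> hnorm H x"
proof -
  have mem: "X n \<in> hcarrier H" "x \<in> hcarrier H" for n using assms by (auto simp: hlim_def)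
  have le: "norm (hnorm H (X n) - hnorm H x) \<le> hnorm H (X n - x)" for n
    using hnorm_triangle[of "X n - x" x] hnorm_triangle[of "x - X n" "X n"] mem
      hnorm_diff_commute[of "X n" x] by (simp add: abs_if)
  have "(\<lambda>n. hnorm H (X n) - hnorm H x) \<longlonglongrightarrow> 0"
  proof (rule Lim_null_comparison)
    show "\<forall>\<^sub>F n in sequentially. norm (hnorm H (X n) - hnorm H x) \<le> hnorm H (X n - x)"
      using le by (rule always_eventually[OF allI])
    show "(\<lambda>n. hnorm H (X n - x)) \<longlonglongrightarrow> 0" using assms by (simp add: hlim_def)
  qed
  then show ?thesis by (rule LIM_zero_cancel)
qed

text \<open>The projection theorem: \<open>v\<close> is the shortest vector in the closure of the
  minimising sequence \<open>x - w n\<close>, and varying it along \<open>W\<close> shows that it is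
  orthogonal to \<open>W\<close>.\<close>

lemma orthogonal_decomposition:
  assumes W: "closed_subspace H W" and x: "x \<in> hcarrier H"
  obtains u v where "u \<in> W" "v \<in> horth W" "x = u + v"
proof -
  note sub = closed_subspaceD(1,2)[OF W]
  have WH: "w \<in> hcarrier H" if "w \<in> W" for w using sub that by blast
  note W_ops = subspace_add[OF sub(2)] subspace_diff[OF sub(2)] subspace_scale[OF sub(2)]
  define C where "C = (\<lambda>w. (hnorm H (x - w))\<^sup>2) ` W"
  define m where "m = Inf C"
  have bdd: "bdd_below C" by (auto simp: C_def intro!: bdd_belowI[of _ 0])
  have m: "m \<le> (hnorm H (x - w))\<^sup>2" if "w \<in> W" for w
    unfolding m_def using bdd that by (intro cInf_lower) (auto simp: C_def)
  have ne: "C \<noteq> {}" using subspace_0[OF sub(2)] by (auto simp: C_def)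
  have "\<exists>w\<in>W. (hnorm H (x - w))\<^sup>2 < m + 1 / Suc n" for n
    using cInf_lessD[OF ne, of "m + 1 / Suc n"] by (auto simp: m_def C_def)
  then obtain w where w: "\<And>n. w n \<in> W" "\<And>n. (hnorm H (x - w n))\<^sup>2 < m + 1 / Suc n"
    by metis
  have wH: "w n \<in> hcarrier H" for n using w(1) WH by blast
  define X where "X = (\<lambda>n. x - w n)"
  have X: "range X \<subseteq> hcarrier H" using x wH by (auto simp: X_def)
  have lim: "(\<lambda>n. (hnorm H (X n))\<^sup>2) \<longlonglongrightarrow> m"
  proof (rule tendsto_sandwich)
    show "\<forall>\<^sub>F n in sequentially. m \<le> (hnorm H (X n))\<^sup>2" using m w(1) by (simp add: X_def)
    show "\<forall>\<^sub>F n in sequentially. (hnorm H (X n))\<^sup>2 \<le> m + 1 / Suc n"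
      using w(2) by (simp add: X_def less_imp_le)
    show "(\<lambda>n. m + 1 / Suc n) \<longlonglongrightarrow> m"
      using tendsto_add[OF tendsto_const LIMSEQ_inverse_real_of_nat, of m]
      by (simp add: inverse_eq_divide)
    show "(\<lambda>n. m) \<longlonglongrightarrow> m" by simp
  qed
  have mid: "m \<le> (hnorm H (hscale H (1/2) (X n + X k)))\<^sup>2" for n k
  proof -
    have "hscale H (1/2) (x + x) = x"
      using scale_left_distrib[of "1/2" "1/2" x] by (simp add: scale_right_distrib)
    then have "hscale H (1/2) (X n + X k) = x - hscale H (1/2) (w n + w k)"
      by (simp add: X_def algebra_simps)
    then show ?thesis using m W_ops w(1) by simp
  qed
  obtain v where v: "hlim X v" using minimizing_sequence[OF X lim mid] .
  have vH: "v \<in> hcarrier H" using v by (simp add: hlim_def)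
  have "hlim w (x - v)"
    using v x wH hnorm_diff_commute[of v] unfolding hlim_def X_def
    by (auto simp: algebra_simps hnorm_diff_commute)
  then have u: "x - v \<in> W" using closed_subspaceD(3)[OF W, of w] w(1) by blast
  have "(\<lambda>n. (hnorm H (X n))\<^sup>2) \<longlonglongrightarrow> (hnorm H v)\<^sup>2"
    by (intro tendsto_power hlim_hnorm v)
  then have nv: "(hnorm H v)\<^sup>2 = m" using lim LIMSEQ_unique by blast
  \<comment> \<open>Moving the nearest point \<open>x - v\<close> by a real multiple of
    \<open>z\<close> stays in \<open>W\<close>, so the squared distance cannot drop below
    \<open>m\<close>.\<close>
  have re: "Re (hinner H v z) = 0" if z: "z \<in> W" for z
  proof (rule real_quadratic_nonneg_imp_0)
    fix t :: real
    have tz: "hscale H (of_real t) z \<in> W" using z W_ops by blast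
    have "m \<le> (hnorm H (x - ((x - v) - hscale H (of_real t) z)))\<^sup>2"
      by (intro m W_ops u tz)
    also have "\<dots> = (hnorm H (v + hscale H (of_real t) z))\<^sup>2" by (simp add: algebra_simps)
    also have "\<dots> = m + 2 * t * Re (hinner H v z) + t\<^sup>2 * (hnorm H z)\<^sup>2"
      using vH WH[OF z]
      by (simp add: hnorm_add_power2 hinner_scale_right nv hnorm_scale power_mult_distrib)
    finally show "0 \<le> 2 * t * Re (hinner H v z) + t\<^sup>2 * (hnorm H z)\<^sup>2" by simp
  qed
  \<comment> \<open>The real parts at \<open>z\<close> and at \<open>hscale H \<i> z\<close> are the
    real and imaginary parts of the inner product.\<close>
  have "hinner H v z = 0" if z: "z \<in> W" for z
    using re[OF z] re[of "hscale H \<i> z"] hinner_imaginary_part[OF vH WH[OF z]] W_ops z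
    by (auto simp: complex_eq_iff)
  then have "v \<in> horth W" using vH by (simp add: horth_def)
  moreover have "x = (x - v) + v" by simp
  ultimately show ?thesis using that u by blast
qed

end

text \<open>Polarisation: the norm of \<open>x + y\<close> determines the real part of the inner
  product, and replacing \<open>y\<close> by its multiple by \<open>\<i>\<close> gives the imaginary
  part.\<close>

lemma unitary_isoI:
  assumes "pre_hilbert_space H" "pre_hilbert_space K" "bij_betw U (hcarrier H) (hcarrier K)"
    and add: "\<And>x y. x \<in> hcarrier H \<Longrightarrow> y \<in> hcarrier H \<Longrightarrow> U (x + y) = U x + U y"
    and scale: "\<And>c x. x \<in> hcarrier H \<Longrightarrow> U (hscale H c x) = hscale K c (U x)"
    and norm: "\<And>x. x \<in> hcarrier H \<Longrightarrow> hnorm K (U x) = hnorm H x"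
  shows "unitary_iso H K U"
proof -
  interpret H: pre_hilbert_space H by fact
  interpret K: pre_hilbert_space K by fact
  have U: "U x \<in> hcarrier K" if "x \<in> hcarrier H" for x
    using assms(3) that by (auto simp: bij_betw_def)
  have re: "Re (hinner K (U x) (U y)) = Re (hinner H x y)"
    if "x \<in> hcarrier H" "y \<in> hcarrier H" for x y
    using H.hnorm_add_power2[OF that] K.hnorm_add_power2[of "U x" "U y"] that U
      norm[of "x + y"] by (simp add: add norm)
  have "hinner K (U x) (U y) = hinner H x y"
    if "x \<in> hcarrier H" "y \<in> hcarrier H" for x y
    using re[OF that] re[of x "hscale H \<i> y"] that U
      H.hinner_imaginary_part[OF that] K.hinner_imaginary_part[of "U x" "U y"]
    by (simp add: scale complex_eq_iff)
  then show ?thesis using assms by (simp add: unitary_iso_def)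
qed

section \<open>Reproducing kernel Hilbert spaces\<close>

definition finsupp :: "'a set \<Rightarrow> ('a \<Rightarrow> complex) set"
  where "finsupp X = {c. finite {x. c x \<noteq> 0} \<and> {x. c x \<noteq> 0} \<subseteq> X}"

text \<open>Conjugate-linear in \<open>c\<close>, so that it can become the inner product of
  \<open>f\<close> with \<open>ksum c\<close>; see \<open>rk_inner_ksum\<close>.\<close>

definition pairing :: "('a \<Rightarrow> complex) \<Rightarrow> ('a \<Rightarrow> complex) \<Rightarrow> complex"
  where "pairing f c = (\<Sum>x | c x \<noteq> 0. cnj (c x) * f x)"

text \<open>Hermitian symmetry makes the double sum real, so positivity can be asked of its real
  part. For fixed \<open>S\<close> and \<open>c\<close> the condition involves finitely many values
  of \<open>k\<close>, hence is closed under pointwise limits.\<close>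

definition pos_kernel :: "'a set \<Rightarrow> ('a \<Rightarrow> 'a \<Rightarrow> complex) \<Rightarrow> bool"
  where "pos_kernel X k \<longleftrightarrow>
    (\<forall>x\<in>X. \<forall>y\<in>X. k y x = cnj (k x y)) \<and>
    (\<forall>S c. finite S \<longrightarrow> S \<subseteq> X \<longrightarrow> 0 \<le> Re (\<Sum>x\<in>S. \<Sum>y\<in>S. cnj (c x) * c y * k x y))"

text \<open>The squared seminorm of \<open>c\<close>. For the kernel of a positive definite function
  \<phi> on a group this is the number \<open>\<phi>(c\<^sup>* c)\<close> of the overview.\<close>

definition kform :: "('a \<Rightarrow> 'a \<Rightarrow> complex) \<Rightarrow> ('a \<Rightarrow> complex) \<Rightarrow> real"
  where "kform k c = Re (\<Sum>x | c x \<noteq> 0. \<Sum>y | c y \<noteq> 0. cnj (c x) * c y * k x y)"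

definition point_mass :: "'a \<Rightarrow> 'a \<Rightarrow> complex"
  where "point_mass x = (\<lambda>y. if y = x then 1 else 0)"

lemma finsupp_0 [simp]: "(\<lambda>x. 0) \<in> finsupp X"
  by (simp add: finsupp_def)

lemma finsupp_add [simp]: "c \<in> finsupp X \<Longrightarrow> d \<in> finsupp X \<Longrightarrow> c + d \<in> finsupp X"
  unfolding finsupp_def
  by (auto intro: finite_subset[of _ "{x. c x \<noteq> 0} \<union> {x. d x \<noteq> 0}"] simp: subset_iff)
     (metis add_0)

lemma finsupp_diff [simp]: "c \<in> finsupp X \<Longrightarrow> d \<in> finsupp X \<Longrightarrow> c - d \<in> finsupp X"
  unfolding finsupp_def
  by (auto intro: finite_subset[of _ "{x. c x \<noteq> 0} \<union> {x. d x \<noteq> 0}"] simp: subset_iff)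
     (metis diff_self)

lemma finsupp_scale [simp]: "c \<in> finsupp X \<Longrightarrow> (\<lambda>x. a * c x) \<in> finsupp X"
  by (auto simp: finsupp_def)

lemma finsupp_mono: "c \<in> finsupp Y \<Longrightarrow> Y \<subseteq> X \<Longrightarrow> c \<in> finsupp X"
  by (auto simp: finsupp_def)

lemma finsupp_point_mass [simp]: "x \<in> X \<Longrightarrow> point_mass x \<in> finsupp X"
  by (auto simp: finsupp_def point_mass_def)

lemma supp_point_mass: "{y. point_mass x y \<noteq> 0} = {x}"
  by (auto simp: point_mass_def)

lemma pairing_superset:
  assumes "finite S" "{x. c x \<noteq> 0} \<subseteq> S"
  shows "pairing f c = (\<Sum>x\<in>S. cnj (c x) * f x)"
  unfolding pairing_def using assms by (intro sum.mono_neutral_left) auto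

lemma pairing_add_left: "pairing (f + g) c = pairing f c + pairing g c"
  by (simp add: pairing_def algebra_simps sum.distrib)

lemma pairing_diff_left: "pairing (f - g) c = pairing f c - pairing g c"
  by (simp add: pairing_def algebra_simps sum_subtractf)

lemma pairing_scale_left: "pairing (\<lambda>x. a * f x) c = a * pairing f c"
  by (simp add: pairing_def sum_distrib_left mult_ac)

lemma pairing_add_right:
  assumes "c \<in> finsupp X" "d \<in> finsupp X"
  shows "pairing f (c + d) = pairing f c + pairing f d"
proof -
  let ?S = "{x. c x \<noteq> 0} \<union> {x. d x \<noteq> 0}"
  have "finite ?S" using assms by (auto simp: finsupp_def)
  then show ?thesis
    by (subst (1 2 3) pairing_superset[of ?S]) (auto simp: algebra_simps sum.distrib)
qed

lemma pairing_scale_right: "pairing f (\<lambda>x. a * c x) = cnj a * pairing f c"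
  by (cases "a = 0") (simp_all add: pairing_def sum_distrib_left mult_ac)

lemma pairing_diff_right:
  assumes "c \<in> finsupp X" "d \<in> finsupp X"
  shows "pairing f (c - d) = pairing f c - pairing f d"
proof -
  have eq: "c - d = c + (\<lambda>x. - 1 * d x)" by auto
  show ?thesis
    unfolding eq using pairing_add_right[OF assms(1) finsupp_scale[OF assms(2)], of f "- 1"]
      pairing_scale_right[of f "- 1" d] by simp
qed

lemma pairing_point_mass [simp]: "pairing f (point_mass x) = f x"
  unfolding pairing_def supp_point_mass by (simp add: point_mass_def)

lemma tendsto_pairing:
  assumes "\<And>x. (\<lambda>n. F n x) \<longlonglongrightarrow> f x"
  shows "(\<lambda>n. pairing (F n) c) \<longlonglongrightarrow> pairing f c"
  unfolding pairing_def by (intro tendsto_sum tendsto_mult tendsto_const assms)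

text \<open>The discriminant argument behind Cauchy-Schwarz: the optimal \<open>s\<close> is
  \<open>1 / D\<close>, and for \<open>D = 0\<close> a large \<open>s\<close> forces
  \<open>p = 0\<close>.\<close>

lemma norm_power2_le_mult_if:
  fixes p :: complex and A D :: real
  assumes le: "\<And>s. 2 * s * (cmod p)\<^sup>2 \<le> A + s\<^sup>2 * (cmod p)\<^sup>2 * D" and D: "0 \<le> D"
  shows "(cmod p)\<^sup>2 \<le> A * D"
proof (cases "D = 0")
  case True
  have "(cmod p)\<^sup>2 = 0"
  proof (rule ccontr)
    assume "(cmod p)\<^sup>2 \<noteq> 0"
    then show False using le[of "(A + 1) / (2 * (cmod p)\<^sup>2)"] True by simp
  qed
  then show ?thesis using True by simp
next
  case False
  then have "2 * (1 / D) * (cmod p)\<^sup>2 \<le> A + (cmod p)\<^sup>2 / D"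
    using le[of "1 / D"] by (simp add: power2_eq_square)
  then show ?thesis using D False by (simp add: field_simps)
qed

text \<open>The inequality of arithmetic and geometric means; it passes from product bounds to the
  additive expression in \<open>rk_sq\<close>.\<close>

lemma two_Re_le_add_if:
  fixes p :: complex
  assumes "(cmod p)\<^sup>2 \<le> A * D" "0 \<le> A" "0 \<le> D"
  shows "2 * Re p \<le> A + D"
proof -
  have "(2 * cmod p)\<^sup>2 \<le> 4 * (A * D)" using assms(1) by (simp add: power_mult_distrib)
  also have "\<dots> \<le> (A + D)\<^sup>2"
    using sum_squares_bound[of A D] by (simp add: power2_sum)
  finally have "2 * cmod p \<le> A + D" by (rule power2_le_imp_le) (use assms in simp)
  then show ?thesis using complex_Re_le_cmod[of p] by linarith
qed

lemma tendsto_0_power2: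
  fixes F :: "'b \<Rightarrow> real"
  assumes "((\<lambda>n. (F n)\<^sup>2) \<longlongrightarrow> 0) A"
  shows "(F \<longlongrightarrow> 0) A"
proof -
  have "((\<lambda>n. sqrt ((F n)\<^sup>2)) \<longlongrightarrow> sqrt 0) A" using assms by (rule tendsto_real_sqrt)
  then show ?thesis by (simp add: tendsto_rabs_zero_iff)
qed

section \<open>Combinations of kernel sections\<close>

locale positive_kernel =
  fixes X :: "'a set" and k :: "'a \<Rightarrow> 'a \<Rightarrow> complex"
  assumes pos: "pos_kernel X k"
begin

text \<open>A combination of the sections \<open>k(., y)\<close>; these will be dense in the
  reproducing kernel space. The value 0 off \<open>X\<close> makes elements of the space determined
  by their values on \<open>X\<close>.\<close>

definition ksum :: "('a \<Rightarrow> complex) \<Rightarrow> 'a \<Rightarrow> complex"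
  where "ksum c = (\<lambda>x. if x \<in> X then \<Sum>y | c y \<noteq> 0. c y * k x y else 0)"

lemma kernel_commute: "x \<in> X \<Longrightarrow> y \<in> X \<Longrightarrow> k y x = cnj (k x y)"
  using pos unfolding pos_kernel_def by blast

lemma kform_nonneg: "c \<in> finsupp X \<Longrightarrow> 0 \<le> kform k c"
  using pos by (auto simp: pos_kernel_def finsupp_def kform_def)

lemma ksum_superset:
  assumes "finite S" "{x. c x \<noteq> 0} \<subseteq> S"
  shows "ksum c = (\<lambda>x. if x \<in> X then \<Sum>y\<in>S. c y * k x y else 0)"
proof -
  have "(\<Sum>y | c y \<noteq> 0. c y * k x y) = (\<Sum>y\<in>S. c y * k x y)" for x
    using assms by (intro sum.mono_neutral_left) auto
  then show ?thesis by (simp add: ksum_def fun_eq_iff)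
qed

lemma ksum_add:
  assumes "c \<in> finsupp X" "d \<in> finsupp X"
  shows "ksum (c + d) = ksum c + ksum d"
proof -
  let ?S = "{x. c x \<noteq> 0} \<union> {x. d x \<noteq> 0}"
  have "finite ?S" using assms by (auto simp: finsupp_def)
  then show ?thesis
    by (subst (1 2 3) ksum_superset[of ?S]) (auto simp: algebra_simps sum.distrib fun_eq_iff)
qed

lemma ksum_scale: "ksum (\<lambda>x. a * c x) = (\<lambda>x. a * ksum c x)"
  by (cases "a = 0") (auto simp: ksum_def sum_distrib_left mult_ac)

lemma ksum_diff:
  assumes "c \<in> finsupp X" "d \<in> finsupp X"
  shows "ksum (c - d) = ksum c - ksum d"
proof -
  have eq: "c - d = c + (\<lambda>x. - 1 * d x)" by auto
  show ?thesis
    unfolding eq using ksum_add[OF assms(1) finsupp_scale[OF assms(2)], of "- 1"]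
      ksum_scale[of "- 1" d] by auto
qed

lemma ksum_point_mass: "ksum (point_mass y) = (\<lambda>x. if x \<in> X then k x y else 0)"
  unfolding ksum_def supp_point_mass by (simp add: point_mass_def fun_eq_iff)

lemma pairing_ksum:
  assumes "d \<in> finsupp X"
  shows "pairing (ksum c) d = (\<Sum>x | d x \<noteq> 0. \<Sum>y | c y \<noteq> 0. cnj (d x) * c y * k x y)"
  unfolding pairing_def
proof (rule sum.cong)
  fix x assume "x \<in> {x. d x \<noteq> 0}"
  then have "x \<in> X" using assms by (auto simp: finsupp_def)
  then show "cnj (d x) * ksum c x = (\<Sum>y | c y \<noteq> 0. cnj (d x) * c y * k x y)"
    by (simp add: ksum_def sum_distrib_left mult_ac)
qed simp

lemma pairing_ksum_commute:
  assumes "c \<in> finsupp X" "d \<in> finsupp X"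
  shows "pairing (ksum d) c = cnj (pairing (ksum c) d)"
proof -
  have "pairing (ksum d) c = (\<Sum>x | c x \<noteq> 0. \<Sum>y | d y \<noteq> 0. cnj (c x) * d y * k x y)"
    using assms by (simp add: pairing_ksum)
  also have "\<dots> = (\<Sum>x | c x \<noteq> 0. \<Sum>y | d y \<noteq> 0. cnj (cnj (d y) * c x * k y x))"
  proof (intro sum.cong refl)
    fix x y assume "x \<in> {x. c x \<noteq> 0}" "y \<in> {y. d y \<noteq> 0}"
    then have "k y x = cnj (k x y)" using assms by (intro kernel_commute) (auto simp: finsupp_def)
    then show "cnj (c x) * d y * k x y = cnj (cnj (d y) * c x * k y x)" by simp
  qed
  also have "\<dots> = cnj (pairing (ksum c) d)"
    using assms by (subst sum.swap) (simp add: pairing_ksum)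
  finally show ?thesis .
qed

lemma kform_eq: "c \<in> finsupp X \<Longrightarrow> kform k c = Re (pairing (ksum c) c)"
  by (simp add: kform_def pairing_ksum)

lemma pairing_ksum_self: "c \<in> finsupp X \<Longrightarrow> pairing (ksum c) c = of_real (kform k c)"
  using pairing_ksum_commute[of c c] by (simp add: kform_eq complex_eq_iff)

lemma kform_add:
  assumes "c \<in> finsupp X" "d \<in> finsupp X"
  shows "kform k (c + d) = kform k c + 2 * Re (pairing (ksum c) d) + kform k d"
  using assms pairing_ksum_commute[OF assms]
  by (simp add: kform_eq ksum_add pairing_add_left pairing_add_right[of _ X])

lemma kform_diff:
  assumes "c \<in> finsupp X" "d \<in> finsupp X"
  shows "kform k (c - d) = kform k c - 2 * Re (pairing (ksum c) d) + kform k d"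
  using assms pairing_ksum_commute[OF assms]
  by (simp add: kform_eq ksum_diff pairing_diff_left pairing_diff_right[of _ X])

lemma kform_scale:
  assumes "c \<in> finsupp X"
  shows "kform k (\<lambda>x. a * c x) = (cmod a)\<^sup>2 * kform k c"
proof -
  have "pairing (ksum (\<lambda>x. a * c x)) (\<lambda>x. a * c x) = (a * cnj a) * pairing (ksum c) c"
    by (simp add: ksum_scale pairing_scale_left pairing_scale_right mult_ac)
  also have "\<dots> = of_real ((cmod a)\<^sup>2 * kform k c)"
    using assms by (simp add: complex_norm_square[symmetric] pairing_ksum_self)
  finally show ?thesis using assms by (simp add: kform_eq[of "\<lambda>x. a * c x"])
qed

lemma pairing_ksum_bound:
  assumes c: "c \<in> finsupp X" and d: "d \<in> finsupp X"
  shows "(cmod (pairing (ksum c) d))\<^sup>2 \<le> kform k c * kform k d"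
proof (rule norm_power2_le_mult_if)
  fix s :: real
  define p where "p = pairing (ksum c) d"
  \<comment> \<open>The factor \<open>p\<close> in front of \<open>d\<close> turns the cross term
    into the real number \<open>s * |p|^2\<close>.\<close>
  have "0 \<le> kform k (c - (\<lambda>x. (s * p) * d x))"
    using c d by (simp add: kform_nonneg)
  also have "\<dots> = kform k c - 2 * Re (cnj (s * p) * p) + (cmod (s * p))\<^sup>2 * kform k d"
    using c d by (simp add: kform_diff pairing_scale_right p_def kform_scale)
  also have "cnj (s * p) * p = of_real (s * (cmod p)\<^sup>2)"
    using complex_norm_square[of p] by (simp add: mult_ac)
  finally show "2 * s * (cmod p)\<^sup>2 \<le> kform k c + s\<^sup>2 * (cmod p)\<^sup>2 * kform k d"
    by (simp add: norm_mult power_mult_distrib)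
qed (use d in \<open>simp add: kform_nonneg\<close>)

text \<open>The reproducing kernel space is realised as the dual of the semi-inner product space of finitely
  supported functions; \<open>rk_sq\<close> below is the square of the dual norm.\<close>

definition rk_bound :: "('a \<Rightarrow> complex) \<Rightarrow> real \<Rightarrow> bool"
  where "rk_bound f C \<longleftrightarrow>
    0 \<le> C \<and> (\<forall>c\<in>finsupp X. (cmod (pairing f c))\<^sup>2 \<le> C * kform k c)"

definition rk_carrier :: "('a \<Rightarrow> complex) set"
  where "rk_carrier = {f. (\<forall>x. x \<notin> X \<longrightarrow> f x = 0) \<and> (\<exists>C. rk_bound f C)}"

definition rk_sq :: "('a \<Rightarrow> complex) \<Rightarrow> real"
  where "rk_sq f = (SUP c\<in>finsupp X. 2 * Re (pairing f c) - kform k c)"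

lemma rk_bound_upper:
  assumes "rk_bound f C" "c \<in> finsupp X"
  shows "2 * Re (pairing f c) - kform k c \<le> C"
  using two_Re_le_add_if[of "pairing f c" C "kform k c"] assms kform_nonneg
  by (auto simp: rk_bound_def)

lemma rk_sq_le: "rk_bound f C \<Longrightarrow> rk_sq f \<le> C"
  unfolding rk_sq_def
  by (rule cSUP_least) (use finsupp_0 in blast, auto intro: rk_bound_upper)

lemma rk_sq_upper:
  assumes "f \<in> rk_carrier" "c \<in> finsupp X"
  shows "2 * Re (pairing f c) - kform k c \<le> rk_sq f"
proof -
  obtain C where "rk_bound f C" using assms by (auto simp: rk_carrier_def)
  then have "bdd_above ((\<lambda>c. 2 * Re (pairing f c) - kform k c) ` finsupp X)"
    using rk_bound_upper by (intro bdd_aboveI[of _ C]) auto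
  then show ?thesis unfolding rk_sq_def using assms by (intro cSUP_upper)
qed

lemma rk_sq_nonneg: "f \<in> rk_carrier \<Longrightarrow> 0 \<le> rk_sq f"
  using rk_sq_upper[of f "\<lambda>x. 0"] by (simp add: pairing_def kform_def)

text \<open>Scaling the test function by \<open>s * p\<close> in the supremum recovers the product
  bound. With \<open>rk_sq_le\<close> this makes \<open>rk_sq f\<close> the least bound, although
  its formula never divides by \<open>kform\<close>, which may vanish.\<close>

lemma rk_bound_rk_sq:
  assumes f: "f \<in> rk_carrier"
  shows "rk_bound f (rk_sq f)"
  unfolding rk_bound_def
proof (intro conjI ballI rk_sq_nonneg f)
  fix c assume c: "c \<in> finsupp X"
  show "(cmod (pairing f c))\<^sup>2 \<le> rk_sq f * kform k c"
  proof (rule norm_power2_le_mult_if)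
    fix s :: real
    define p where "p = pairing f c"
    have "2 * Re (pairing f (\<lambda>x. (s * p) * c x)) - kform k (\<lambda>x. (s * p) * c x) \<le> rk_sq f"
      using f c by (intro rk_sq_upper) auto
    moreover have "pairing f (\<lambda>x. (s * p) * c x) = of_real (s * (cmod p)\<^sup>2)"
      using complex_norm_square[of p] unfolding pairing_scale_right p_def[symmetric]
      by (simp add: mult_ac)
    ultimately show "2 * s * (cmod p)\<^sup>2 \<le> rk_sq f + s\<^sup>2 * (cmod p)\<^sup>2 * kform k c"
      using c by (simp add: kform_scale norm_mult power_mult_distrib)
  qed (use c in \<open>simp add: kform_nonneg\<close>)
qed

lemma pairing_bound:
  "f \<in> rk_carrier \<Longrightarrow> c \<in> finsupp X \<Longrightarrow> (cmod (pairing f c))\<^sup>2 \<le> rk_sq f * kform k c"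
  using rk_bound_rk_sq by (auto simp: rk_bound_def)

lemma rk_carrierI: "(\<And>x. x \<notin> X \<Longrightarrow> f x = 0) \<Longrightarrow> rk_bound f C \<Longrightarrow> f \<in> rk_carrier"
  by (auto simp: rk_carrier_def)

lemma rk_carrier_outside: "f \<in> rk_carrier \<Longrightarrow> x \<notin> X \<Longrightarrow> f x = 0"
  by (simp add: rk_carrier_def)

text \<open>The crude constant comes from \<open>(a + b)^2 \<le> 2 a^2 + 2 b^2\<close>; it is enough
  for membership in the space and for limit arguments.\<close>

lemma rk_bound_add:
  assumes "rk_bound f C" "rk_bound g D"
  shows "rk_bound (f + g) (2 * C + 2 * D)"
proof -
  have "(cmod (pairing (f + g) c))\<^sup>2 \<le> (2 * C + 2 * D) * kform k c" if "c \<in> finsupp X" for c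
  proof -
    have "(cmod (pairing (f + g) c))\<^sup>2 \<le> (cmod (pairing f c) + cmod (pairing g c))\<^sup>2"
      unfolding pairing_add_left by (intro power_mono norm_triangle_ineq) auto
    also have "\<dots> \<le> 2 * (cmod (pairing f c))\<^sup>2 + 2 * (cmod (pairing g c))\<^sup>2"
      using sum_squares_bound[of "cmod (pairing f c)" "cmod (pairing g c)"]
      by (simp add: power2_sum)
    also have "\<dots> \<le> 2 * (C * kform k c) + 2 * (D * kform k c)"
      using assms that by (intro add_mono mult_left_mono) (auto simp: rk_bound_def)
    finally show ?thesis by (simp add: algebra_simps)
  qed
  then show ?thesis using assms by (simp add: rk_bound_def)
qed

lemma rk_bound_scale:
  assumes "rk_bound f C"
  shows "rk_bound (\<lambda>x. a * f x) ((cmod a)\<^sup>2 * C)"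
  using assms
  by (auto simp: rk_bound_def pairing_scale_left norm_mult power_mult_distrib mult.assoc
      intro!: mult_left_mono)

lemma rk_bound_diff:
  assumes "rk_bound f C" "rk_bound g D"
  shows "rk_bound (f - g) (2 * C + 2 * D)"
proof -
  have eq: "f - g = f + (\<lambda>x. - 1 * g x)" by auto
  show ?thesis
    unfolding eq using rk_bound_add[OF assms(1) rk_bound_scale[OF assms(2), of "- 1"]] by simp
qed

lemma rk_carrier_add [simp]: "f \<in> rk_carrier \<Longrightarrow> g \<in> rk_carrier \<Longrightarrow> f + g \<in> rk_carrier"
  using rk_bound_add by (fastforce simp: rk_carrier_def)

lemma rk_carrier_diff [simp]: "f \<in> rk_carrier \<Longrightarrow> g \<in> rk_carrier \<Longrightarrow> f - g \<in> rk_carrier"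
  using rk_bound_diff by (fastforce simp: rk_carrier_def)

lemma rk_carrier_scale [simp]: "f \<in> rk_carrier \<Longrightarrow> (\<lambda>x. a * f x) \<in> rk_carrier"
  using rk_bound_scale by (fastforce simp: rk_carrier_def)

lemma rk_sq_diff_le:
  "f \<in> rk_carrier \<Longrightarrow> g \<in> rk_carrier \<Longrightarrow> rk_sq (f - g) \<le> 2 * rk_sq f + 2 * rk_sq g"
  by (intro rk_sq_le rk_bound_diff rk_bound_rk_sq)

lemma rk_bound_ksum: "c \<in> finsupp X \<Longrightarrow> rk_bound (ksum c) (kform k c)"
  by (simp add: rk_bound_def pairing_ksum_bound kform_nonneg)

lemma ksum_carrier [simp]: "c \<in> finsupp X \<Longrightarrow> ksum c \<in> rk_carrier"
  using rk_bound_ksum by (auto simp: rk_carrier_def ksum_def)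

lemma rk_sq_ksum: "c \<in> finsupp X \<Longrightarrow> rk_sq (ksum c) = kform k c"
  using rk_sq_upper[of "ksum c" c] rk_sq_le[OF rk_bound_ksum] kform_eq by fastforce

lemma rk_sq_0: "rk_sq (\<lambda>x. 0) = 0"
proof -
  have "rk_bound (\<lambda>x. 0) 0" by (simp add: rk_bound_def pairing_def)
  then show ?thesis using rk_sq_le rk_sq_nonneg[OF rk_carrierI] by fastforce
qed

section \<open>Approximation by combinations of kernel sections\<close>

definition rk_approx :: "('a \<Rightarrow> complex) \<Rightarrow> nat \<Rightarrow> 'a \<Rightarrow> complex"
  where "rk_approx f n =
    (SOME c. c \<in> finsupp X \<and> rk_sq f - 1 / Suc n < 2 * Re (pairing f c) - kform k c)"

lemma rk_approx:
  shows rk_approx_finsupp [simp]: "rk_approx f n \<in> finsupp X"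
    and rk_approx_less:
      "rk_sq f - 1 / Suc n < 2 * Re (pairing f (rk_approx f n)) - kform k (rk_approx f n)"
proof -
  have "\<exists>c. c \<in> finsupp X \<and> rk_sq f - 1 / Suc n < 2 * Re (pairing f c) - kform k c"
    using less_cSupD[of "(\<lambda>c. 2 * Re (pairing f c) - kform k c) ` finsupp X"
        "rk_sq f - 1 / Suc n"] finsupp_0
    unfolding rk_sq_def by fastforce
  from someI_ex[OF this, folded rk_approx_def]
  show "rk_approx f n \<in> finsupp X"
    and "rk_sq f - 1 / Suc n < 2 * Re (pairing f (rk_approx f n)) - kform k (rk_approx f n)"
    by auto
qed

text \<open>Near-maximisers of the supremum defining \<open>rk_sq f\<close> give good approximations
  of \<open>f\<close>: test the supremum with \<open>c + d\<close> and expand the quadratic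
  form.\<close>

lemma rk_sq_diff_ksum:
  assumes f: "f \<in> rk_carrier" and c: "c \<in> finsupp X"
  shows "rk_sq (f - ksum c) \<le> rk_sq f - (2 * Re (pairing f c) - kform k c)"
  unfolding rk_sq_def[of "f - ksum c"]
proof (rule cSUP_least)
  fix d assume d: "d \<in> finsupp X"
  have "2 * Re (pairing f (c + d)) - kform k (c + d) \<le> rk_sq f"
    using f c d by (intro rk_sq_upper) auto
  then show "2 * Re (pairing (f - ksum c) d) - kform k d
      \<le> rk_sq f - (2 * Re (pairing f c) - kform k c)"
    using c d by (simp add: kform_add pairing_add_right[of _ X] pairing_diff_left)
qed (use finsupp_0 in blast)

definition approximates :: "(nat \<Rightarrow> 'a \<Rightarrow> complex) \<Rightarrow> ('a \<Rightarrow> complex) \<Rightarrow> bool"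
  where "approximates c f \<longleftrightarrow> range c \<subseteq> finsupp X \<and> (\<lambda>n. rk_sq (f - ksum (c n))) \<longlonglongrightarrow> 0"

lemma approximates_rk_approx:
  assumes "f \<in> rk_carrier"
  shows "approximates (rk_approx f) f"
  unfolding approximates_def
proof
  show "(\<lambda>n. rk_sq (f - ksum (rk_approx f n))) \<longlonglongrightarrow> 0"
  proof (rule tendsto_sandwich[of "\<lambda>n. 0"])
    show "\<forall>\<^sub>F n in sequentially. 0 \<le> rk_sq (f - ksum (rk_approx f n))"
      using assms by (simp add: rk_sq_nonneg)
    have "rk_sq (f - ksum (rk_approx f n)) \<le> 1 / Suc n" for n
      using rk_sq_diff_ksum[OF assms rk_approx_finsupp, of f n] rk_approx_less[of f n]
      by linarith
    then show "\<forall>\<^sub>F n in sequentially. rk_sq (f - ksum (rk_approx f n)) \<le> 1 / Suc n" by simp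
    show "(\<lambda>n. 1 / real (Suc n)) \<longlonglongrightarrow> 0"
      using LIMSEQ_inverse_real_of_nat by (simp add: inverse_eq_divide)
  qed simp
qed auto

lemma approximates_ksum: "c \<in> finsupp X \<Longrightarrow> approximates (\<lambda>n. c) (ksum c)"
  using rk_sq_0 by (auto simp: approximates_def zero_fun_def)

lemma kform_diff_le:
  assumes "f \<in> rk_carrier" "c \<in> finsupp X" "d \<in> finsupp X"
  shows "kform k (c - d) \<le> 2 * rk_sq (f - ksum c) + 2 * rk_sq (f - ksum d)"
proof -
  have "kform k (c - d) = rk_sq ((f - ksum d) - (f - ksum c))"
    using assms by (simp add: rk_sq_ksum[symmetric] ksum_diff)
  also have "\<dots> \<le> 2 * rk_sq (f - ksum d) + 2 * rk_sq (f - ksum c)"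
    using assms by (intro rk_sq_diff_le) auto
  finally show ?thesis by simp
qed

text \<open>Two approximating sequences of \<open>g\<close> differ by functions whose
  \<open>kform\<close> tends to 0, so they lead to the same limit in
  \<open>rk_inner\<close>.\<close>

lemma pairing_approximates_diff:
  assumes f: "f \<in> rk_carrier" and g: "g \<in> rk_carrier"
    and c: "approximates c g" and d: "approximates d g"
  shows "(\<lambda>n. pairing f (c n) - pairing f (d n)) \<longlonglongrightarrow> 0"
proof -
  have cd: "c n \<in> finsupp X" "d n \<in> finsupp X" for n using c d by (auto simp: approximates_def)
  have "(\<lambda>n. (cmod (pairing f (c n) - pairing f (d n)))\<^sup>2) \<longlonglongrightarrow> 0"
  proof (rule tendsto_sandwich[of "\<lambda>n. 0"])
    show "\<forall>\<^sub>F n in sequentially. (cmod (pairing f (c n) - pairing f (d n)))\<^sup>2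
        \<le> rk_sq f * (2 * rk_sq (g - ksum (c n)) + 2 * rk_sq (g - ksum (d n)))"
    proof (intro always_eventually allI)
      fix n
      have "(cmod (pairing f (c n) - pairing f (d n)))\<^sup>2 \<le> rk_sq f * kform k (c n - d n)"
        using pairing_bound[OF f, of "c n - d n"] cd
        by (simp add: pairing_diff_right[of _ X])
      also have "\<dots> \<le> rk_sq f * (2 * rk_sq (g - ksum (c n)) + 2 * rk_sq (g - ksum (d n)))"
        by (intro mult_left_mono kform_diff_le g cd rk_sq_nonneg f)
      finally show "(cmod (pairing f (c n) - pairing f (d n)))\<^sup>2
        \<le> rk_sq f * (2 * rk_sq (g - ksum (c n)) + 2 * rk_sq (g - ksum (d n)))" .
    qed
    have "(\<lambda>n. rk_sq f * (2 * rk_sq (g - ksum (c n)) + 2 * rk_sq (g - ksum (d n))))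
        \<longlonglongrightarrow> rk_sq f * (2 * 0 + 2 * 0)"
      using c d by (intro tendsto_intros) (auto simp: approximates_def)
    then show "(\<lambda>n. rk_sq f * (2 * rk_sq (g - ksum (c n)) + 2 * rk_sq (g - ksum (d n))))
        \<longlonglongrightarrow> 0" by simp
  qed auto
  then have "(\<lambda>n. cmod (pairing f (c n) - pairing f (d n))) \<longlonglongrightarrow> 0"
    by (rule tendsto_0_power2)
  then show ?thesis by (rule tendsto_norm_zero_cancel)
qed

lemma pairing_approximates_convergent:
  assumes f: "f \<in> rk_carrier" and g: "g \<in> rk_carrier" and c: "approximates c g"
  shows "convergent (\<lambda>n. pairing f (c n))"
proof -
  have cX: "c n \<in> finsupp X" for n using c by (auto simp: approximates_def)
  define q where "q = (\<lambda>n. rk_sq (g - ksum (c n)))"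
  have q0: "0 \<le> q n" for n using g cX by (simp add: q_def rk_sq_nonneg)
  \<comment> \<open>The summand 1 permits division by \<open>Q\<close> even if
    \<open>rk_sq f = 0\<close>.\<close>
  define Q where "Q = rk_sq f + 1"
  have Q: "0 < Q" using rk_sq_nonneg[OF f] by (simp add: Q_def)
  have bound: "(cmod (pairing f (c n) - pairing f (c m)))\<^sup>2 \<le> Q * (2 * q n + 2 * q m)" for n m
  proof -
    have "(cmod (pairing f (c n) - pairing f (c m)))\<^sup>2 \<le> rk_sq f * kform k (c n - c m)"
      using pairing_bound[OF f, of "c n - c m"] cX by (simp add: pairing_diff_right[of _ X])
    also have "\<dots> \<le> Q * kform k (c n - c m)"
      using cX by (intro mult_right_mono kform_nonneg) (auto simp: Q_def)
    also have "\<dots> \<le> Q * (2 * q n + 2 * q m)"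
      unfolding q_def using Q by (intro mult_left_mono kform_diff_le g cX) auto
    finally show ?thesis .
  qed
  have "Cauchy (\<lambda>n. pairing f (c n))"
  proof (rule metric_CauchyI)
    fix e :: real assume e: "0 < e"
    have "q \<longlonglongrightarrow> 0" using c by (simp add: q_def approximates_def)
    moreover have "0 < e\<^sup>2 / (4 * Q)" using e Q by simp
    ultimately obtain N where N: "\<And>n. n \<ge> N \<Longrightarrow> dist (q n) 0 < e\<^sup>2 / (4 * Q)"
      unfolding LIMSEQ_def by blast
    have "dist (pairing f (c n)) (pairing f (c m)) < e" if "n \<ge> N" "m \<ge> N" for n m
    proof -
      have "q n < e\<^sup>2 / (4 * Q)" "q m < e\<^sup>2 / (4 * Q)"
        using N[OF that(1)] N[OF that(2)] q0 by (simp_all add: dist_real_def)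
      then have "2 * q n + 2 * q m < 2 * (e\<^sup>2 / (4 * Q)) + 2 * (e\<^sup>2 / (4 * Q))"
        by (intro add_strict_mono mult_strict_left_mono) auto
      also have "\<dots> = e\<^sup>2 / Q" by simp
      finally have "Q * (2 * q n + 2 * q m) < e\<^sup>2" using Q by (simp add: field_simps)
      then have "(cmod (pairing f (c n) - pairing f (c m)))\<^sup>2 < e\<^sup>2"
        using bound[of n m] by linarith
      then show ?thesis using e by (simp add: dist_norm power_less_imp_less_base)
    qed
    then show "\<exists>N. \<forall>m\<ge>N. \<forall>n\<ge>N. dist (pairing f (c m)) (pairing f (c n)) < e" by blast
  qed
  then show ?thesis by (rule Cauchy_convergent)
qed

section \<open>The inner product\<close>

definition rk_inner :: "('a \<Rightarrow> complex) \<Rightarrow> ('a \<Rightarrow> complex) \<Rightarrow> complex"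
  where "rk_inner f g = lim (\<lambda>n. pairing f (rk_approx g n))"

text \<open>Frees \<open>rk_inner\<close> from the chosen sequence \<open>rk_approx\<close>: every
  approximating sequence computes it.\<close>

lemma rk_inner_tendsto:
  assumes "f \<in> rk_carrier" "g \<in> rk_carrier" "approximates c g"
  shows "(\<lambda>n. pairing f (c n)) \<longlonglongrightarrow> rk_inner f g"
proof -
  have "(\<lambda>n. pairing f (rk_approx g n)) \<longlonglongrightarrow> rk_inner f g"
    unfolding rk_inner_def convergent_LIMSEQ_iff[symmetric]
    by (rule pairing_approximates_convergent[OF assms(1,2) approximates_rk_approx[OF assms(2)]])
  from tendsto_add[OF this pairing_approximates_diff[OF assms(1,2,3) approximates_rk_approx]]
  show ?thesis using assms(2) by simp
qed

lemma rk_inner_ksum: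
  assumes "f \<in> rk_carrier" "c \<in> finsupp X"
  shows "rk_inner f (ksum c) = pairing f c"
  using rk_inner_tendsto[OF assms(1) ksum_carrier approximates_ksum] assms(2)
  by (simp add: LIMSEQ_const_iff)

lemma rk_inner_add:
  assumes "f \<in> rk_carrier" "g \<in> rk_carrier" "h \<in> rk_carrier"
  shows "rk_inner (f + g) h = rk_inner f h + rk_inner g h"
proof -
  note lim = rk_inner_tendsto[OF _ assms(3) approximates_rk_approx[OF assms(3)]]
  have "(\<lambda>n. pairing (f + g) (rk_approx h n)) \<longlonglongrightarrow> rk_inner f h + rk_inner g h"
    unfolding pairing_add_left using assms by (intro tendsto_add lim)
  then show ?thesis using LIMSEQ_unique[OF lim] assms by simp
qed

lemma rk_inner_scale:
  assumes "f \<in> rk_carrier" "h \<in> rk_carrier"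
  shows "rk_inner (\<lambda>x. a * f x) h = a * rk_inner f h"
proof -
  note lim = rk_inner_tendsto[OF _ assms(2) approximates_rk_approx[OF assms(2)]]
  have "(\<lambda>n. pairing (\<lambda>x. a * f x) (rk_approx h n)) \<longlonglongrightarrow> a * rk_inner f h"
    unfolding pairing_scale_left using assms by (intro tendsto_mult tendsto_const lim)
  then show ?thesis using LIMSEQ_unique[OF lim] assms by simp
qed

lemma approximates_kform_bound:
  assumes g: "g \<in> rk_carrier" and c: "c \<in> finsupp X"
  shows "kform k c \<le> 2 * rk_sq g + 2 * rk_sq (g - ksum c)"
proof -
  have "kform k c = rk_sq (g - (g - ksum c))" using c by (simp add: rk_sq_ksum)
  also have "\<dots> \<le> 2 * rk_sq g + 2 * rk_sq (g - ksum c)"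
    using g c by (intro rk_sq_diff_le) auto
  finally show ?thesis .
qed

text \<open>Approximating both arguments at once carries properties of the form on finitely
  supported functions, such as Hermitian symmetry, over to the whole space.\<close>

lemma rk_inner_tendsto_pairing_ksum:
  assumes f: "f \<in> rk_carrier" and g: "g \<in> rk_carrier"
    and c: "approximates c f" and d: "approximates d g"
  shows "(\<lambda>n. pairing (ksum (c n)) (d n)) \<longlonglongrightarrow> rk_inner f g"
proof -
  have cd: "c n \<in> finsupp X" "d n \<in> finsupp X" for n using c d by (auto simp: approximates_def)
  define p where "p = (\<lambda>n. rk_sq (f - ksum (c n)))"
  define q where "q = (\<lambda>n. rk_sq (g - ksum (d n)))"
  have "(\<lambda>n. (cmod (pairing f (d n) - pairing (ksum (c n)) (d n)))\<^sup>2) \<longlonglongrightarrow> 0"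
  proof (rule tendsto_sandwich[of "\<lambda>n. 0"])
    show "\<forall>\<^sub>F n in sequentially. (cmod (pairing f (d n) - pairing (ksum (c n)) (d n)))\<^sup>2
        \<le> p n * (2 * rk_sq g + 2 * q n)"
    proof (intro always_eventually allI)
      fix n
      have "(cmod (pairing f (d n) - pairing (ksum (c n)) (d n)))\<^sup>2 \<le> p n * kform k (d n)"
        using pairing_bound[of "f - ksum (c n)" "d n"] f cd
        by (simp add: pairing_diff_left p_def)
      also have "\<dots> \<le> p n * (2 * rk_sq g + 2 * q n)"
        unfolding q_def p_def
        by (intro mult_left_mono approximates_kform_bound g cd rk_sq_nonneg)
          (simp add: f cd)
      finally show "(cmod (pairing f (d n) - pairing (ksum (c n)) (d n)))\<^sup>2
        \<le> p n * (2 * rk_sq g + 2 * q n)" .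
    qed
    have "(\<lambda>n. p n * (2 * rk_sq g + 2 * q n)) \<longlonglongrightarrow> 0 * (2 * rk_sq g + 2 * 0)"
      using c d unfolding p_def q_def by (intro tendsto_intros) (auto simp: approximates_def)
    then show "(\<lambda>n. p n * (2 * rk_sq g + 2 * q n)) \<longlonglongrightarrow> 0" by simp
  qed auto
  then have "(\<lambda>n. pairing f (d n) - pairing (ksum (c n)) (d n)) \<longlonglongrightarrow> 0"
    by (rule tendsto_norm_zero_cancel[OF tendsto_0_power2])
  from tendsto_diff[OF rk_inner_tendsto[OF f g d] this] show ?thesis by simp
qed

lemma rk_inner_commute:
  assumes f: "f \<in> rk_carrier" and g: "g \<in> rk_carrier"
  shows "rk_inner f g = cnj (rk_inner g f)"
proof -
  let ?c = "rk_approx f" and ?d = "rk_approx g"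
  note c = approximates_rk_approx[OF f] and d = approximates_rk_approx[OF g]
  have "(\<lambda>n. cnj (pairing (ksum (?d n)) (?c n))) \<longlonglongrightarrow> cnj (rk_inner g f)"
    by (intro tendsto_cnj rk_inner_tendsto_pairing_ksum f g c d)
  then have "(\<lambda>n. pairing (ksum (?c n)) (?d n)) \<longlonglongrightarrow> cnj (rk_inner g f)"
    by (subst pairing_ksum_commute) auto
  then show ?thesis using rk_inner_tendsto_pairing_ksum[OF f g c d] LIMSEQ_unique by blast
qed

text \<open>Along the near-maximisers, twice the pairing minus the form tends to
  \<open>rk_sq f\<close> by their choice, and to \<open>2 Re <f,f> - Re <f,f>\<close> by the two
  limit lemmas.\<close>

lemma Re_rk_inner_self:
  assumes f: "f \<in> rk_carrier"
  shows "Re (rk_inner f f) = rk_sq f"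
proof -
  let ?c = "rk_approx f"
  note c = approximates_rk_approx[OF f]
  have "(\<lambda>n. 2 * Re (pairing f (?c n)) - Re (pairing (ksum (?c n)) (?c n)))
      \<longlonglongrightarrow> 2 * Re (rk_inner f f) - Re (rk_inner f f)"
    by (intro tendsto_intros rk_inner_tendsto rk_inner_tendsto_pairing_ksum f c)
  then have *: "(\<lambda>n. 2 * Re (pairing f (?c n)) - kform k (?c n)) \<longlonglongrightarrow> Re (rk_inner f f)"
    by (simp add: kform_eq)
  have "(\<lambda>n. 2 * Re (pairing f (?c n)) - kform k (?c n)) \<longlonglongrightarrow> rk_sq f"
  proof (rule tendsto_sandwich)
    show "\<forall>\<^sub>F n in sequentially. rk_sq f - 1 / Suc n \<le> 2 * Re (pairing f (?c n)) - kform k (?c n)"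
      using rk_approx_less[of f] by (simp add: less_imp_le)
    show "\<forall>\<^sub>F n in sequentially. 2 * Re (pairing f (?c n)) - kform k (?c n) \<le> rk_sq f"
      using f by (simp add: rk_sq_upper)
    show "(\<lambda>n. rk_sq f - 1 / real (Suc n)) \<longlonglongrightarrow> rk_sq f"
      using tendsto_diff[OF tendsto_const LIMSEQ_inverse_real_of_nat, of "rk_sq f"]
      by (simp add: inverse_eq_divide)
  qed simp
  with * show ?thesis using LIMSEQ_unique by blast
qed

text \<open>Point evaluations are bounded. This yields definiteness of the inner product and
  pointwise convergence of Cauchy sequences.\<close>

lemma norm_apply_le:
  assumes "f \<in> rk_carrier" "x \<in> X"
  shows "(cmod (f x))\<^sup>2 \<le> rk_sq f * kform k (point_mass x)"
  using pairing_bound[of f "point_mass x"] assms by simp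

section \<open>The Hilbert space and its completeness\<close>

definition rk_space :: "('a \<Rightarrow> complex) hilbert"
  where "rk_space = \<lparr>hcarrier = rk_carrier, hscale = (\<lambda>a f x. a * f x), hinner = rk_inner\<rparr>"

lemma rk_space_simps [simp]:
  "hcarrier rk_space = rk_carrier"
  "hscale rk_space = (\<lambda>a f x. a * f x)"
  "hinner rk_space = rk_inner"
  by (simp_all add: rk_space_def)

lemma pre_hilbert_space_rk_space: "pre_hilbert_space rk_space"
proof -
  interpret vector_space "hscale rk_space"
    by unfold_locales (auto simp: algebra_simps)
  show ?thesis
  proof
    have "(\<lambda>x. 0) \<in> rk_carrier" by (rule rk_carrierI[of _ 0]) (auto simp: rk_bound_def pairing_def)
    then show "subspace (hcarrier rk_space)"
      unfolding subspace_def by (simp add: zero_fun_def)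
    fix f assume f: "f \<in> hcarrier rk_space" "hinner rk_space f f = 0"
    then have "rk_sq f = 0" using Re_rk_inner_self[of f] by simp
    then have "f x = 0" if "x \<in> X" for x using norm_apply_le[OF _ that, of f] f by simp
    then show "f = 0" using f rk_carrier_outside[of f] by (auto simp: fun_eq_iff)
  qed (auto simp: rk_inner_add rk_inner_scale Re_rk_inner_self rk_sq_nonneg
      intro: rk_inner_commute)
qed

lemma hnorm_rk_space: "f \<in> rk_carrier \<Longrightarrow> hnorm rk_space f = sqrt (rk_sq f)"
  by (simp add: hnorm_def Re_rk_inner_self)

text \<open>A Cauchy sequence converges pointwise, and its bounds survive in the limit because each
  of them tests only finitely many points.\<close>

theorem hilbert_space_rk_space: "hilbert_space rk_space"
proof -
  interpret pre_hilbert_space rk_space by (rule pre_hilbert_space_rk_space)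
  show ?thesis
  proof
    show "Hdist.mcomplete" unfolding Hdist.mcomplete_def
    proof (intro allI impI)
      fix F assume F: "Hdist.MCauchy F"
      then have FX: "F n \<in> rk_carrier" for n
        unfolding Hdist.MCauchy_def by auto
      have cau: "\<exists>N. \<forall>n\<ge>N. \<forall>m\<ge>N. rk_sq (F n - F m) \<le> e" if e: "0 < e" for e
      proof -
        have "0 < sqrt e" using e by simp
        with F obtain N where N: "\<And>n m. n \<ge> N \<Longrightarrow> m \<ge> N \<Longrightarrow> hdist rk_space (F n) (F m) < sqrt e"
          unfolding Hdist.MCauchy_def by blast
        have "rk_sq (F n - F m) \<le> e" if "n \<ge> N" "m \<ge> N" for n m
          using N[OF that] FX by (simp add: hdist_def hnorm_rk_space)
        then show ?thesis by blast
      qed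
      have "convergent (\<lambda>n. F n x)" for x
      proof (cases "x \<in> X")
        case False
        have "(\<lambda>n. F n x) = (\<lambda>n. 0)" by (rule ext) (rule rk_carrier_outside[OF FX False])
        then show ?thesis by (simp add: convergent_const)
      next
        case True
        define B where "B = kform k (point_mass x) + 1"
        have B: "0 < B" using True kform_nonneg[of "point_mass x"] by (simp add: B_def)
        have "Cauchy (\<lambda>n. F n x)"
        proof (rule metric_CauchyI)
          fix e :: real assume e: "0 < e"
          then have "0 < e\<^sup>2 / (2 * B)" using B by simp
          from cau[OF this] obtain N
            where N: "\<And>n m. n \<ge> N \<Longrightarrow> m \<ge> N \<Longrightarrow> rk_sq (F n - F m) \<le> e\<^sup>2 / (2 * B)" by blast
          have "dist (F n x) (F m x) < e" if "n \<ge> N" "m \<ge> N" for n m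
          proof -
            have "(cmod ((F n - F m) x))\<^sup>2 \<le> rk_sq (F n - F m) * kform k (point_mass x)"
              by (rule norm_apply_le[OF rk_carrier_diff[OF FX FX] True])
            also have "\<dots> \<le> rk_sq (F n - F m) * B"
              by (intro mult_left_mono rk_sq_nonneg rk_carrier_diff FX) (simp add: B_def)
            also have "\<dots> \<le> (e\<^sup>2 / (2 * B)) * B"
              using B N[OF that] by (intro mult_right_mono) auto
            also have "\<dots> = e\<^sup>2 / 2" using B by simp
            also have "\<dots> < e\<^sup>2" using e by simp
            finally show ?thesis using e by (simp add: dist_norm power_less_imp_less_base)
          qed
          then show "\<exists>N. \<forall>m\<ge>N. \<forall>n\<ge>N. dist (F m x) (F n x) < e" by blast
        qed
        then show ?thesis by (rule Cauchy_convergent)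
      qed
      then have lim: "(\<lambda>n. F n x) \<longlonglongrightarrow> lim (\<lambda>n. F n x)" for x
        by (simp add: convergent_LIMSEQ_iff)
      define f where "f = (\<lambda>x. lim (\<lambda>n. F n x))"
      have Ff: "(\<lambda>n. F n x) \<longlonglongrightarrow> f x" for x using lim by (simp add: f_def)
      \<comment> \<open>Let \<open>m\<close> tend to infinity in the bound on
        \<open>F n - F m\<close>, for each fixed test function \<open>c\<close>. This gives both
        membership of the limit and convergence to it.\<close>
      have bd: "\<exists>N. \<forall>n\<ge>N. rk_bound (F n - f) e" if e: "0 < e" for e
      proof -
        from cau[OF e] obtain N
          where N: "\<And>n m. n \<ge> N \<Longrightarrow> m \<ge> N \<Longrightarrow> rk_sq (F n - F m) \<le> e" by blast
        have "rk_bound (F n - f) e" if n: "n \<ge> N" for n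
          unfolding rk_bound_def
        proof (intro conjI ballI)
          fix c assume c: "c \<in> finsupp X"
          have "(\<lambda>m. (cmod (pairing (F n - F m) c))\<^sup>2) \<longlonglongrightarrow> (cmod (pairing (F n - f) c))\<^sup>2"
            by (intro tendsto_intros tendsto_pairing) (auto intro: tendsto_intros Ff)
          moreover have "(cmod (pairing (F n - F m) c))\<^sup>2 \<le> e * kform k c" if "m \<ge> N" for m
          proof -
            have "(cmod (pairing (F n - F m) c))\<^sup>2 \<le> rk_sq (F n - F m) * kform k c"
              using FX c by (intro pairing_bound) auto
            also have "\<dots> \<le> e * kform k c"
              using c N[OF n that] by (intro mult_right_mono kform_nonneg) auto
            finally show ?thesis .
          qed
          ultimately show "(cmod (pairing (F n - f) c))\<^sup>2 \<le> e * kform k c"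
            by (intro LIMSEQ_le_const2) auto
        qed (use e in simp)
        then show ?thesis by blast
      qed
      have out: "f x = 0" if "x \<notin> X" for x
      proof -
        have "(\<lambda>n. F n x) = (\<lambda>n. 0)" by (rule ext) (rule rk_carrier_outside[OF FX that])
        then show ?thesis using Ff[of x] by (simp add: LIMSEQ_const_iff)
      qed
      have mem: "F n - f \<in> rk_carrier" if "rk_bound (F n - f) e" for n e
        using that by (intro rk_carrierI[of _ e]) (simp_all add: out rk_carrier_outside[OF FX])
      obtain N where "rk_bound (F N - f) 1" using bd[of 1] by auto
      \<comment> \<open>The limit is recovered as \<open>F N - (F N - f)\<close>.\<close>
      from rk_carrier_diff[OF FX[of N] mem[OF this]] have f: "f \<in> rk_carrier"
        by (metis diff_diff_eq2 add_diff_cancel_left')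
      have "limitin Hdist.mtopology F f sequentially"
        unfolding Hdist.limitin_metric
      proof (intro conjI allI impI)
        fix e :: real assume e: "0 < e"
        then have "0 < e\<^sup>2 / 4" by simp
        from bd[OF this] obtain N where N: "\<And>n. n \<ge> N \<Longrightarrow> rk_bound (F n - f) (e\<^sup>2 / 4)" by blast
        have "hdist rk_space (F n) f < e" if "n \<ge> N" for n
        proof -
          have "rk_sq (F n - f) \<le> e\<^sup>2 / 4" by (intro rk_sq_le N that)
          also have "\<dots> < e\<^sup>2" using e by simp
          finally have "sqrt (rk_sq (F n - f)) < e" using e by (intro real_less_lsqrt) auto
          then show ?thesis using f FX by (simp add: hdist_def hnorm_rk_space)
        qed
        then show "\<forall>\<^sub>F n in sequentially. F n \<in> hcarrier rk_space \<and> hdist rk_space (F n) f < e"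
          using FX by (auto simp: eventually_sequentially)
      qed (use f in simp)
      then show "\<exists>f. limitin Hdist.mtopology F f sequentially" by blast
    qed
  qed
qed

end

section \<open>Extreme points minimising a lower semicontinuous affine function\<close>

text \<open>Strict convexity of the squared modulus with its explicit defect, which is what must
  vanish at a maximiser.\<close>

lemma norm_power2_convex_combination:
  fixes a b :: complex and t w :: real
  shows "w * (cmod (of_real t * a + of_real (1 - t) * b))\<^sup>2
    = t * (w * (cmod a)\<^sup>2) + (1 - t) * (w * (cmod b)\<^sup>2) - t * (1 - t) * (w * (cmod (a - b))\<^sup>2)"
  unfolding cmod_power2 by (simp add: power2_eq_square algebra_simps)

text \<open>A maximiser of the continuous function \<open>q\<close>, a weighted sum of squared
  moduli, is extreme: for a convex combination the convexity defects are nonnegative and sum to at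
  most 0, so the two points agree on \<open>X\<close>. Countability provides summable
  weights.\<close>

lemma extreme_point_of_compact:
  fixes M :: "('a \<Rightarrow> complex) set"
  assumes M: "compact M" "M \<noteq> {}" and X: "countable X"
    and out: "\<And>\<psi> x. \<psi> \<in> M \<Longrightarrow> x \<notin> X \<Longrightarrow> \<psi> x = 0"
    and bd: "\<And>\<psi> x. \<psi> \<in> M \<Longrightarrow> cmod (\<psi> x) \<le> 1"
  obtains \<psi> where "\<psi> \<in> M"
    and "\<And>\<psi>1 \<psi>2 t. \<psi>1 \<in> M \<Longrightarrow> \<psi>2 \<in> M \<Longrightarrow> 0 < t \<Longrightarrow> t < 1 \<Longrightarrow>
      \<psi> = (\<lambda>x. of_real t * \<psi>1 x + of_real (1 - t) * \<psi>2 x) \<Longrightarrow> \<psi>1 = \<psi>2"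
proof -
  \<comment> \<open>For finite nonempty \<open>X\<close> the enumeration repeats an element; the
    geometric weights and the bound 1 on all values keep the series convergent.\<close>
  define e where "e = from_nat_into X"
  define f where "f = (\<lambda>\<psi> n. (1/2) ^ n * (cmod (\<psi> (e n)))\<^sup>2)"
  define q where "q = (\<lambda>\<psi>. \<Sum>n. f \<psi> n)"
  have fbd: "norm (f \<psi> n) \<le> (1/2) ^ n" if "\<psi> \<in> M" for \<psi> n
  proof -
    have "(cmod (\<psi> (e n)))\<^sup>2 \<le> 1" using bd[OF that] by (simp add: power_le_one)
    then show ?thesis by (simp add: f_def field_simps)
  qed
  have geo: "summable (\<lambda>n. (1/2 :: real) ^ n)" by (rule summable_geometric) simp
  have summ: "summable (f \<psi>)" if "\<psi> \<in> M" for \<psi>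
    by (rule summable_comparison_test'[OF geo]) (use fbd[OF that] in blast)
  have "continuous_on M q" unfolding q_def
  proof (rule uniform_limit_theorem)
    show "uniform_limit M (\<lambda>n \<psi>. \<Sum>i<n. f \<psi> i) (\<lambda>\<psi>. \<Sum>n. f \<psi> n) sequentially"
      by (rule Weierstrass_m_test[OF fbd geo])
    have "continuous_on M (\<lambda>\<psi>. f \<psi> i)" for i
      unfolding f_def
      by (intro continuous_intros continuous_on_subset[OF continuous_on_product_coordinates]) auto
    then show "\<forall>\<^sub>F n in sequentially. continuous_on M (\<lambda>\<psi>. \<Sum>i<n. f \<psi> i)"
      by (intro always_eventually allI continuous_on_sum)
  qed simp
  then obtain \<psi> where \<psi>: "\<psi> \<in> M" and max: "\<And>\<theta>. \<theta> \<in> M \<Longrightarrow> q \<theta> \<le> q \<psi>"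
    using continuous_attains_sup[OF M] by metis
  show ?thesis
  proof (rule that[OF \<psi>])
    fix \<psi>1 \<psi>2 and t :: real
    assume *: "\<psi>1 \<in> M" "\<psi>2 \<in> M" "0 < t" "t < 1"
      and eq: "\<psi> = (\<lambda>x. of_real t * \<psi>1 x + of_real (1 - t) * \<psi>2 x)"
    define g where "g = (\<lambda>n. t * f \<psi>1 n + (1 - t) * f \<psi>2 n)"
    define d where "d = (\<lambda>n. t * (1 - t) * ((1/2) ^ n * (cmod (\<psi>1 (e n) - \<psi>2 (e n)))\<^sup>2))"
    have d: "d n = g n - f \<psi> n" for n
      using norm_power2_convex_combination[of "(1/2) ^ n" t "\<psi>1 (e n)" "\<psi>2 (e n)"]
      by (simp add: eq d_def g_def f_def)
    have g: "g sums (t * q \<psi>1 + (1 - t) * q \<psi>2)"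
      unfolding g_def q_def using * by (intro sums_add sums_mult summable_sums summ)
    then have ds: "d sums (t * q \<psi>1 + (1 - t) * q \<psi>2 - q \<psi>)"
      unfolding d q_def using \<psi> by (intro sums_diff summable_sums summ) auto
    \<comment> \<open>Maximality of \<psi> bounds the total defect \<open>suminf d\<close> by
      0.\<close>
    have "t * q \<psi>1 + (1 - t) * q \<psi>2 \<le> t * q \<psi> + (1 - t) * q \<psi>"
      using * max by (intro add_mono mult_left_mono) auto
    then have "suminf d \<le> 0" using ds by (simp add: sums_iff algebra_simps)
    moreover have d0: "0 \<le> d n" for n using * by (simp add: d_def)
    ultimately have "suminf d = 0"
      using suminf_nonneg[of d] ds by (auto simp: sums_iff)
    then have dn: "d n = 0" for n
      using suminf_eq_zero_iff[of d] ds d0 by (auto simp: sums_iff)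
    show "\<psi>1 = \<psi>2"
    proof
      fix x
      show "\<psi>1 x = \<psi>2 x"
      proof (cases "x \<in> X")
        case True
        then obtain n where "x = e n" using from_nat_into_surj[OF X] e_def by metis
        then show ?thesis using dn[of n] * by (simp add: d_def)
      next
        case False
        then show ?thesis using out * by metis
      qed
    qed
  qed
qed

text \<open>
  The sums \<open>\<Sum>i<n. F i \<psi>\<close> increase to a lower semicontinuous affine function, which attains its
  minimum over \<open>K\<close> on a closed face \<open>M\<close>; a maximiser over \<open>M\<close> of a continuous strictly convex
  function (a weighted \<open>\<ell>\<^sup>2\<close>-norm) is an extreme point of \<open>M\<close>, hence of \<open>K\<close>.
\<close>

lemma extreme_point_below:
  fixes K :: "('a \<Rightarrow> complex) set" and F :: "nat \<Rightarrow> ('a \<Rightarrow> complex) \<Rightarrow> real"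
  assumes K: "compact K" and closed: "closed K" and X: "countable X"
    and out: "\<And>\<psi> x. \<psi> \<in> K \<Longrightarrow> x \<notin> X \<Longrightarrow> \<psi> x = 0"
    and bd: "\<And>\<psi> x. \<psi> \<in> K \<Longrightarrow> cmod (\<psi> x) \<le> 1"
    and cont: "\<And>i. continuous_on K (F i)"
    and nonneg: "\<And>i \<psi>. \<psi> \<in> K \<Longrightarrow> 0 \<le> F i \<psi>"
    and affine: "\<And>i \<psi>1 \<psi>2 t. \<psi>1 \<in> K \<Longrightarrow> \<psi>2 \<in> K \<Longrightarrow> 0 < t \<Longrightarrow> t < 1 \<Longrightarrow>
      F i (\<lambda>x. of_real t * \<psi>1 x + of_real (1 - t) * \<psi>2 x) = t * F i \<psi>1 + (1 - t) * F i \<psi>2"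
    and \<phi>: "\<phi> \<in> K" "\<And>n. (\<Sum>i<n. F i \<phi>) \<le> s"
  obtains \<psi> where "\<psi> \<in> K" "\<And>i. F i \<psi> \<le> s"
    and "\<And>\<psi>1 \<psi>2 t. \<psi>1 \<in> K \<Longrightarrow> \<psi>2 \<in> K \<Longrightarrow> 0 < t \<Longrightarrow> t < 1 \<Longrightarrow>
      \<psi> = (\<lambda>x. of_real t * \<psi>1 x + of_real (1 - t) * \<psi>2 x) \<Longrightarrow> \<psi>1 = \<psi>2"
proof -
  define S where "S = (\<lambda>n \<psi>. \<Sum>i<n. F i \<psi>)"
  \<comment> \<open>\<open>m\<close> is the infimum over \<open>K\<close> of the supremum of the
    partial sums; using real upper bounds \<open>r\<close> leaves out the points where the partial
    sums are unbounded.\<close>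
  define T where "T = {r. \<exists>\<psi>\<in>K. \<forall>n. S n \<psi> \<le> r}"
  define m where "m = Inf T"
  have S0: "0 \<le> S n \<psi>" if "\<psi> \<in> K" for n \<psi>
    unfolding S_def using that by (intro sum_nonneg nonneg)
  have Smono: "incseq (\<lambda>n. S n \<psi>)" if "\<psi> \<in> K" for \<psi>
    using that nonneg by (intro incseq_SucI) (simp add: S_def)
  have T0: "bdd_below T"
  proof (rule bdd_belowI[of _ 0])
    fix r assume "r \<in> T"
    then obtain \<psi> where "\<psi> \<in> K" "\<forall>n. S n \<psi> \<le> r" by (auto simp: T_def)
    then show "0 \<le> r" using S0 order_trans by blast
  qed
  have sT: "s \<in> T" using \<phi> by (auto simp: T_def S_def)
  have mT: "m \<le> r" if "\<psi> \<in> K" "\<And>n. S n \<psi> \<le> r" for r \<psi>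
    unfolding m_def using that T0 by (intro cInf_lower) (auto simp: T_def)
  have contS: "continuous_on K (S n)" for n
    unfolding S_def by (intro continuous_on_sum cont)
  \<comment> \<open>Sublevel sets of the partial sums with slack \<open>1 / Suc j\<close>. They are
    closed, and a point nearly attaining \<open>m\<close> lies in any finite number of them, so by
    compactness they have a common point in \<open>K\<close>, where \<open>m\<close> is
    attained.\<close>
  define L where "L = (\<lambda>(n, j). {\<psi> \<in> K. S n \<psi> \<le> m + 1 / Suc j})"
  define M where "M = K \<inter> (\<Inter>p. L p)"
  have M_iff: "\<psi> \<in> M \<longleftrightarrow> \<psi> \<in> K \<and> (\<forall>n. S n \<psi> \<le> m)" for \<psi>
  proof -
    have "(\<forall>j. S n \<psi> \<le> m + 1 / Suc j) \<longleftrightarrow> S n \<psi> \<le> m" for n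
    proof
      assume *: "\<forall>j. S n \<psi> \<le> m + 1 / Suc j"
      show "S n \<psi> \<le> m"
      proof (rule field_le_epsilon)
        fix e :: real assume "0 < e"
        then obtain j where "1 / Suc j < e" using nat_approx_posE by blast
        then show "S n \<psi> \<le> m + e" using *[rule_format, of j] by linarith
      qed
    qed (auto intro: order_trans)
    then show ?thesis by (auto simp: M_def L_def)
  qed
  have Lcl: "closed (L p)" for p
    using continuous_on_closed_Collect_le[OF contS continuous_on_const closed]
    by (cases p) (simp add: L_def)
  have "K \<inter> (\<Inter>p. L p) \<noteq> {}"
  proof (rule compact_imp_fip_image[OF K])
    fix I :: "(nat \<times> nat) set" assume I: "finite I"
    then obtain J where J: "\<And>p. p \<in> I \<Longrightarrow> snd p \<le> J"
      using finite_nat_set_iff_bounded_le[of "snd ` I"] by auto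
    have "Inf T < m + 1 / Suc J" by (simp add: m_def)
    then obtain r where r: "r \<in> T" "r < m + 1 / Suc J" using cInf_lessD sT by blast
    then obtain \<psi> where \<psi>: "\<psi> \<in> K" "\<And>n. S n \<psi> \<le> r" by (auto simp: T_def)
    have "S n \<psi> \<le> m + 1 / Suc j" if "(n, j) \<in> I" for n j
    proof -
      have "1 / real (Suc J) \<le> 1 / real (Suc j)" using J[OF that] by (simp add: frac_le)
      then show ?thesis using \<psi>(2)[of n] r(2) by linarith
    qed
    then have "\<psi> \<in> K \<inter> (\<Inter>p\<in>I. L p)" using \<psi> by (auto simp: L_def)
    then show "K \<inter> (\<Inter>p\<in>I. L p) \<noteq> {}" by blast
  qed (use Lcl in auto)
  then have Mne: "M \<noteq> {}" by (simp add: M_def)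
  have Mc: "compact M" unfolding M_def
    using K Lcl by (intro compact_Int_closed closed_INT) auto
  have MK: "M \<subseteq> K" by (auto simp: M_def)
  obtain \<psi> where \<psi>: "\<psi> \<in> M"
    and ext: "\<And>\<psi>1 \<psi>2 t. \<psi>1 \<in> M \<Longrightarrow> \<psi>2 \<in> M \<Longrightarrow> 0 < t \<Longrightarrow> t < 1 \<Longrightarrow>
      \<psi> = (\<lambda>x. of_real t * \<psi>1 x + of_real (1 - t) * \<psi>2 x) \<Longrightarrow> \<psi>1 = \<psi>2"
    by (rule extreme_point_of_compact[OF Mc Mne X]) (use MK out bd in \<open>auto\<close>)
  have face: "\<psi>1 \<in> M"
    if *: "\<psi>1 \<in> K" "\<psi>2 \<in> K" "0 < t" "t < 1"
      and eq: "\<psi> = (\<lambda>x. of_real t * \<psi>1 x + of_real (1 - t) * \<psi>2 x)" for \<psi>1 \<psi>2 t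
  proof -
    have S_eq: "S n \<psi> = t * S n \<psi>1 + (1 - t) * S n \<psi>2" for n
      unfolding S_def eq using affine[OF *]
      by (simp add: sum.distrib sum_distrib_left)
    \<comment> \<open>Monotonicity of the partial sums decouples the two indices, so
      \<open>n\<close> can stay fixed while \<open>k\<close> varies.\<close>
    have le: "t * S n \<psi>1 + (1 - t) * S k \<psi>2 \<le> m" for n k
    proof -
      have "t * S n \<psi>1 + (1 - t) * S k \<psi>2 \<le> t * S (max n k) \<psi>1 + (1 - t) * S (max n k) \<psi>2"
        using * Smono[of \<psi>1] Smono[of \<psi>2]
        by (intro add_mono mult_left_mono) (auto simp: incseq_def)
      also have "\<dots> \<le> m" using \<psi> by (simp add: S_eq[symmetric] M_iff)
      finally show ?thesis .
    qed
    have "S n \<psi>1 \<le> m" for n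
    proof -
      have "S k \<psi>2 \<le> (m - t * S n \<psi>1) / (1 - t)" for k
        using le[of n k] * by (simp add: field_simps)
      \<comment> \<open>Every upper bound for the sums at \<psi>2 is at least \<open>m\<close>, by
        minimality of \<open>m\<close>; this leaves at most \<open>t * m\<close> for the term of
        \<psi>1.\<close>
      then have "m \<le> (m - t * S n \<psi>1) / (1 - t)" by (rule mT[OF *(2)])
      then have "t * S n \<psi>1 \<le> t * m" using * by (simp add: field_simps)
      then show ?thesis using * by simp
    qed
    then show ?thesis using * by (simp add: M_iff)
  qed
  show ?thesis
  proof (rule that)
    show "\<psi> \<in> K" using \<psi> MK by blast
    have "m \<le> s" unfolding m_def using sT T0 by (rule cInf_lower)
    then have S_le: "S n \<psi> \<le> s" for n using \<psi> M_iff order_trans by blast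
    show "F i \<psi> \<le> s" for i
      using S_le[of "Suc i"] S0[OF \<open>\<psi> \<in> K\<close>, of i] by (simp add: S_def)
    fix \<psi>1 \<psi>2 and t :: real
    assume *: "\<psi>1 \<in> K" "\<psi>2 \<in> K" "0 < t" "t < 1"
      and eq: "\<psi> = (\<lambda>x. of_real t * \<psi>1 x + of_real (1 - t) * \<psi>2 x)"
    have "\<psi>2 \<in> M"
      using * eq by (intro face[of \<psi>2 \<psi>1 "1 - t"]) (auto simp: add.commute)
    then show "\<psi>1 = \<psi>2" using ext face * eq by blast
  qed
qed

section \<open>Unitary representations and their coefficients\<close>

lemma mult_unitary_group:
  assumes "U \<in> carrier (unitary_group H)" "V \<in> carrier (unitary_group H)"
  shows "U \<otimes>\<^bsub>unitary_group H\<^esub> V = compose (hcarrier H) U V"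
proof -
  have "U \<in> Bij (hcarrier H)" "V \<in> Bij (hcarrier H)"
    using assms by (auto simp: unitary_group_def Bij_def unitary_iso_def)
  then show ?thesis by (simp add: unitary_group_def BijGroup_def)
qed

lemma one_unitary_group: "\<one>\<^bsub>unitary_group H\<^esub> = (\<lambda>x\<in>hcarrier H. x)"
  by (simp add: unitary_group_def BijGroup_def)

text \<open>Positivity of this left-invariant kernel on \<open>carrier G\<close> is positive
  definiteness of \<psi>.\<close>

definition shift_kernel :: "('g, 'm) monoid_scheme \<Rightarrow> ('g \<Rightarrow> complex) \<Rightarrow> 'g \<Rightarrow> 'g \<Rightarrow> complex"
  where "shift_kernel G \<psi> = (\<lambda>x y. \<psi> (inv\<^bsub>G\<^esub> x \<otimes>\<^bsub>G\<^esub> y))"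

locale unitary_representation = group G
  for G :: "('g, 'm) monoid_scheme" and H :: "('h::ab_group_add) hilbert"
    and \<pi> :: "'g \<Rightarrow> 'h \<Rightarrow> 'h" +
  assumes rep: "unitary_rep G H \<pi>"
begin

sublocale hilbert_space H
  using rep by (simp add: unitary_rep_def)

lemma rep_group_hom: "group_hom G (unitary_group H) \<pi>"
  using rep group_unitary_group[OF hilbert_space_axioms]
  by (simp add: group_hom_def group_hom_axioms_def unitary_rep_def group_axioms)

lemma rep_unitary_iso: "g \<in> carrier G \<Longrightarrow> unitary_iso H H (\<pi> g)"
  using group_hom.hom_closed[OF rep_group_hom, of g] by (simp add: unitary_group_def)

lemma rep_extensional: "g \<in> carrier G \<Longrightarrow> \<pi> g \<in> extensional (hcarrier H)"
  using group_hom.hom_closed[OF rep_group_hom, of g] by (simp add: unitary_group_def)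

lemma rep_closed [simp]: "g \<in> carrier G \<Longrightarrow> x \<in> hcarrier H \<Longrightarrow> \<pi> g x \<in> hcarrier H"
  using rep_unitary_iso[of g] by (auto simp: unitary_iso_def bij_betw_def)

lemma rep_add:
  "g \<in> carrier G \<Longrightarrow> x \<in> hcarrier H \<Longrightarrow> y \<in> hcarrier H \<Longrightarrow> \<pi> g (x + y) = \<pi> g x + \<pi> g y"
  using rep_unitary_iso[of g] by (auto simp: unitary_iso_def)

lemma rep_scale:
  "g \<in> carrier G \<Longrightarrow> x \<in> hcarrier H \<Longrightarrow> \<pi> g (hscale H c x) = hscale H c (\<pi> g x)"
  using rep_unitary_iso[of g] by (auto simp: unitary_iso_def)

lemma rep_hinner:
  "g \<in> carrier G \<Longrightarrow> x \<in> hcarrier H \<Longrightarrow> y \<in> hcarrier H \<Longrightarrow>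
    hinner H (\<pi> g x) (\<pi> g y) = hinner H x y"
  using rep_unitary_iso[of g] by (auto simp: unitary_iso_def)

lemma rep_hnorm: "g \<in> carrier G \<Longrightarrow> x \<in> hcarrier H \<Longrightarrow> hnorm H (\<pi> g x) = hnorm H x"
  by (simp add: hnorm_def rep_hinner)

lemma rep_mult:
  "g \<in> carrier G \<Longrightarrow> h \<in> carrier G \<Longrightarrow> x \<in> hcarrier H \<Longrightarrow> \<pi> (g \<otimes>\<^bsub>G\<^esub> h) x = \<pi> g (\<pi> h x)"
  using group_hom.hom_mult[OF rep_group_hom, of g h] group_hom.hom_closed[OF rep_group_hom]
  by (simp add: mult_unitary_group compose_def)

lemma rep_one: "x \<in> hcarrier H \<Longrightarrow> \<pi> \<one>\<^bsub>G\<^esub> x = x"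
  using group_hom.hom_one[OF rep_group_hom] by (simp add: one_unitary_group)

lemma rep_diff:
  assumes "g \<in> carrier G" "x \<in> hcarrier H" "y \<in> hcarrier H"
  shows "\<pi> g (x - y) = \<pi> g x - \<pi> g y"
  using rep_add[of g "x - y" y] assms by simp

lemma rep_inv:
  "g \<in> carrier G \<Longrightarrow> x \<in> hcarrier H \<Longrightarrow> \<pi> (inv\<^bsub>G\<^esub> g) (\<pi> g x) = x"
  "g \<in> carrier G \<Longrightarrow> x \<in> hcarrier H \<Longrightarrow> \<pi> g (\<pi> (inv\<^bsub>G\<^esub> g) x) = x"
  using rep_mult[of "inv\<^bsub>G\<^esub> g" g x] rep_mult[of g "inv\<^bsub>G\<^esub> g" x] by (simp_all add: rep_one)

lemma rep_adjoint:
  assumes "g \<in> carrier G" "x \<in> hcarrier H" "y \<in> hcarrier H"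
  shows "hinner H (\<pi> g x) y = hinner H x (\<pi> (inv\<^bsub>G\<^esub> g) y)"
  using rep_hinner[of g x "\<pi> (inv\<^bsub>G\<^esub> g) y"] assms by (simp add: rep_inv)

lemma rep_hlim:
  assumes "g \<in> carrier G" "hlim X x"
  shows "hlim (\<lambda>n. \<pi> g (X n)) (\<pi> g x)"
proof -
  have mem: "X n \<in> hcarrier H" "x \<in> hcarrier H" for n using assms by (auto simp: hlim_def)
  then have "hnorm H (\<pi> g (X n) - \<pi> g x) = hnorm H (X n - x)" for n
    using assms(1) rep_hnorm[of g "X n - x"] by (simp add: rep_diff)
  then show ?thesis using assms mem by (auto simp: hlim_def)
qed

text \<open>The unit of \<open>unitary_group H\<close> is the restricted identity, so by
  extensionality equality with it need only be tested on the carrier.\<close>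

lemma rep_kernel_iff:
  "g \<in> rep_kernel G H \<pi> \<longleftrightarrow> g \<in> carrier G \<and> (\<forall>x\<in>hcarrier H. \<pi> g x = x)"
proof -
  have "\<pi> g = (\<lambda>x\<in>hcarrier H. x) \<longleftrightarrow> (\<forall>x\<in>hcarrier H. \<pi> g x = x)" if "g \<in> carrier G"
    using rep_extensional[OF that] by (auto simp: extensional_def fun_eq_iff restrict_def)
  then show ?thesis by (auto simp: kernel_def one_unitary_group)
qed

lemma rep_kernel_normal: "rep_kernel G H \<pi> \<lhd> G"
  by (rule group_hom.normal_kernel[OF rep_group_hom])

text \<open>The adjoint of \<open>\<pi> g\<close> is the operator of the inverse of
  \<open>g\<close>, which preserves \<open>W\<close> as well.\<close>

lemma invariant_horth:
  assumes W: "invariant_closed_subspace G H \<pi> W"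
  shows "invariant_closed_subspace G H \<pi> (horth W)"
proof -
  have WH: "W \<subseteq> hcarrier H" and inv: "\<And>g x. g \<in> carrier G \<Longrightarrow> x \<in> W \<Longrightarrow> \<pi> g x \<in> W"
    using W closed_subspaceD(1) by (auto simp: invariant_closed_subspace_def)
  have "\<pi> g y \<in> horth W" if "g \<in> carrier G" "y \<in> horth W" for g y
  proof -
    have "hinner H (\<pi> g y) x = 0" if "x \<in> W" for x
      using that \<open>y \<in> horth W\<close> \<open>g \<in> carrier G\<close> inv[of "inv\<^bsub>G\<^esub> g" x] WH
        rep_adjoint[of g y x] by (auto simp: horth_def)
    then show ?thesis using that by (simp add: horth_def)
  qed
  then show ?thesis using closed_subspace_horth[OF WH] by (simp add: invariant_closed_subspace_def)
qed

section \<open>Vectors fixed by a normal subgroup\<close>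

definition fixed_vectors :: "'g set \<Rightarrow> 'h set"
  where "fixed_vectors N = {x \<in> hcarrier H. \<forall>n\<in>N. \<pi> n x = x}"

text \<open>Invariance under the whole group comes from normality, by writing
  \<open>n g = g (g^-1 n g)\<close>; closedness comes from continuity of each
  \<open>\<pi> n\<close>.\<close>

lemma invariant_fixed_vectors:
  assumes N: "N \<lhd> G"
  shows "invariant_closed_subspace G H \<pi> (fixed_vectors N)"
proof -
  have NG: "n \<in> carrier G" if "n \<in> N" for n
    using N that subgroup.mem_carrier normal_imp_subgroup by metis
  have "closed_subspace H (fixed_vectors N)"
  proof (rule closed_subspaceI)
    show "fixed_vectors N \<subseteq> hcarrier H" by (auto simp: fixed_vectors_def)
    have "\<pi> n 0 = 0" if "n \<in> N" for n using rep_diff[of n 0 0] NG[OF that] by simp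
    then show "subspace (fixed_vectors N)"
      using NG by (auto simp: subspace_def fixed_vectors_def rep_add rep_scale)
    fix X x assume X: "range X \<subseteq> fixed_vectors N" "hlim X x"
    have "\<pi> n x = x" if n: "n \<in> N" for n
    proof (rule hlim_unique)
      have "(\<lambda>k. \<pi> n (X k)) = X" using X(1) n by (auto simp: fixed_vectors_def)
      then show "hlim X (\<pi> n x)" using rep_hlim[OF NG[OF n] X(2)] by simp
    qed (rule X)
    then show "x \<in> fixed_vectors N" using X(2) by (simp add: fixed_vectors_def hlim_def)
  qed
  moreover have "\<pi> g x \<in> fixed_vectors N" if g: "g \<in> carrier G" and x: "x \<in> fixed_vectors N" for g x
  proof -
    have xH: "x \<in> hcarrier H" using x by (simp add: fixed_vectors_def)
    have "\<pi> n (\<pi> g x) = \<pi> g x" if n: "n \<in> N" for n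
    proof -
      have n': "inv\<^bsub>G\<^esub> g \<otimes>\<^bsub>G\<^esub> n \<otimes>\<^bsub>G\<^esub> g \<in> N" using N g n by (rule normal.inv_op_closed1)
      have "n \<otimes>\<^bsub>G\<^esub> g = g \<otimes>\<^bsub>G\<^esub> (inv\<^bsub>G\<^esub> g \<otimes>\<^bsub>G\<^esub> n \<otimes>\<^bsub>G\<^esub> g)"
        using g NG[OF n] by (simp add: m_assoc[symmetric])
      then have "\<pi> n (\<pi> g x) = \<pi> g (\<pi> (inv\<^bsub>G\<^esub> g \<otimes>\<^bsub>G\<^esub> n \<otimes>\<^bsub>G\<^esub> g) x)"
        using g xH NG[OF n] NG[OF n'] by (simp add: rep_mult[symmetric])
      then show ?thesis using x n' by (simp add: fixed_vectors_def)
    qed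
    then show ?thesis using g xH by (simp add: fixed_vectors_def)
  qed
  ultimately show ?thesis by (simp add: invariant_closed_subspace_def)
qed

text \<open>An intertwiner between subrepresentations of \<open>H\<^sup>N\<close> and of its orthogonal complement has
  \<open>N\<close>-fixed values, so the two are disjoint.\<close>

lemma factor_rep_fixed_vectors:
  assumes "factor_rep G H \<pi>" and N: "N \<lhd> G" and "\<not> N \<subseteq> rep_kernel G H \<pi>"
  shows "fixed_vectors N = {0}"
proof (rule ccontr)
  assume V: "fixed_vectors N \<noteq> {0}"
  let ?V = "fixed_vectors N" and ?W = "horth (fixed_vectors N)"
  note Vinv = invariant_fixed_vectors[OF N]
  have Vc: "closed_subspace H ?V" using Vinv by (simp add: invariant_closed_subspace_def)
  have VH: "?V \<subseteq> hcarrier H" using Vc by (rule closed_subspaceD)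
  have NG: "n \<in> carrier G" if "n \<in> N" for n
    using N that subgroup.mem_carrier normal_imp_subgroup by metis
  \<comment> \<open>A zero complement would make every vector fixed, which puts \<open>N\<close>
    into the kernel.\<close>
  have W: "?W \<noteq> {0}"
  proof
    assume W: "?W = {0}"
    have "x \<in> ?V" if "x \<in> hcarrier H" for x
      using orthogonal_decomposition[OF Vc that] W by auto
    then show False
      using assms(3) NG by (auto simp: rep_kernel_iff fixed_vectors_def subset_iff)
  qed
  have "orthogonal_direct_sum H ?V ?W"
    using orthogonal_decomposition[OF Vc] horth_swap[OF _ _ VH]
    unfolding orthogonal_direct_sum_def by metis
  moreover have "disjoint_reps G (sub_hilbert H ?V) (sub_rep \<pi> ?V) (sub_hilbert H ?W) (sub_rep \<pi> ?W)"
    unfolding disjoint_reps_def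
  proof (intro notI, elim exE conjE)
    fix V' W' assume
      V': "invariant_closed_subspace G (sub_hilbert H ?V) (sub_rep \<pi> ?V) V'" and
      W': "invariant_closed_subspace G (sub_hilbert H ?W) (sub_rep \<pi> ?W) W'" "W' \<noteq> {0}" and
      eq: "equivalent_reps G (sub_hilbert (sub_hilbert H ?V) V') (sub_rep (sub_rep \<pi> ?V) V')
        (sub_hilbert (sub_hilbert H ?W) W') (sub_rep (sub_rep \<pi> ?W) W')"
    from V' have V'_sub: "V' \<subseteq> ?V"
      by (simp add: invariant_closed_subspace_def closed_subspace_def)
    from W' have W'_sub: "W' \<subseteq> ?W" and "0 \<in> W'"
      using module.subspace_0[OF module_axioms, of W']
      by (simp_all add: invariant_closed_subspace_def closed_subspace_def)
    obtain U where bij: "bij_betw U V' W'"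
      and U: "\<And>g x. g \<in> carrier G \<Longrightarrow> x \<in> V' \<Longrightarrow>
        U (sub_rep (sub_rep \<pi> ?V) V' g x) = sub_rep (sub_rep \<pi> ?W) W' g (U x)"
      using eq unfolding equivalent_reps_def unitary_iso_def by auto
    have "y = 0" if y: "y \<in> W'" for y
    proof -
      obtain x where x: "x \<in> V'" "y = U x" using bij y by (auto simp: bij_betw_def)
      have "\<pi> n y = y" if n: "n \<in> N" for n
      proof -
        have "\<pi> n x = x" using x V'_sub n by (auto simp: fixed_vectors_def)
        then show ?thesis
          using U[OF NG[OF n] x(1)] x y V'_sub W'_sub by (auto simp: sub_rep_def subset_iff)
      qed
      then have "y \<in> ?V" using y W'_sub by (auto simp: fixed_vectors_def horth_def)
      then show ?thesis using disjoint_horth[of y ?V] y W'_sub by blast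
    qed
    then show False using W'(2) \<open>0 \<in> W'\<close> by blast
  qed
  ultimately show False
    using assms(1) V W Vinv invariant_horth[OF Vinv] by (auto simp: factor_rep_def)
qed

section \<open>Matrix coefficients\<close>

definition coeff :: "'h \<Rightarrow> 'g \<Rightarrow> complex"
  where "coeff \<xi> = (\<lambda>g. if g \<in> carrier G then hinner H (\<pi> g \<xi>) \<xi> else 0)"

lemma shift_kernel_coeff:
  assumes "\<xi> \<in> hcarrier H" "x \<in> carrier G" "y \<in> carrier G"
  shows "shift_kernel G (coeff \<xi>) x y = hinner H (\<pi> y \<xi>) (\<pi> x \<xi>)"
  using assms by (simp add: shift_kernel_def coeff_def rep_mult rep_adjoint)

text \<open>The source of positive definiteness of coefficients: the form of their kernel is a
  squared norm.\<close>

lemma hinner_combination: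
  assumes "\<xi> \<in> hcarrier H" "S \<subseteq> carrier G"
  shows "hinner H (\<Sum>x\<in>S. hscale H (c x) (\<pi> x \<xi>)) (\<Sum>x\<in>S. hscale H (c x) (\<pi> x \<xi>))
    = (\<Sum>x\<in>S. \<Sum>y\<in>S. cnj (c x) * c y * shift_kernel G (coeff \<xi>) x y)"
proof -
  have SG: "x \<in> carrier G" if "x \<in> S" for x using assms that by blast
  let ?v = "\<Sum>x\<in>S. hscale H (c x) (\<pi> x \<xi>)"
  have v: "?v \<in> hcarrier H" using assms SG by (intro hcarrier_sum) simp
  have "hinner H ?v ?v = (\<Sum>x\<in>S. hinner H ?v (hscale H (c x) (\<pi> x \<xi>)))"
    using assms SG v by (intro hinner_sum_right) simp_all
  also have "\<dots> = (\<Sum>x\<in>S. \<Sum>y\<in>S. hinner H (hscale H (c y) (\<pi> y \<xi>)) (hscale H (c x) (\<pi> x \<xi>)))"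
    using assms SG by (intro sum.cong refl hinner_sum_left) simp_all
  also have "\<dots> = (\<Sum>x\<in>S. \<Sum>y\<in>S. cnj (c x) * c y * shift_kernel G (coeff \<xi>) x y)"
    using assms SG
    by (intro sum.cong refl) (simp add: shift_kernel_coeff hinner_scale hinner_scale_right)
  finally show ?thesis .
qed

lemma pos_kernel_coeff:
  assumes "\<xi> \<in> hcarrier H"
  shows "pos_kernel (carrier G) (shift_kernel G (coeff \<xi>))"
  unfolding pos_kernel_def
proof (intro conjI ballI allI impI)
  fix x y assume "x \<in> carrier G" "y \<in> carrier G"
  then show "shift_kernel G (coeff \<xi>) y x = cnj (shift_kernel G (coeff \<xi>) x y)"
    using assms hinner_commute[of "\<pi> x \<xi>" "\<pi> y \<xi>"] by (simp add: shift_kernel_coeff)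
next
  fix S and c :: "'g \<Rightarrow> complex" assume S: "finite S" "S \<subseteq> carrier G"
  have "(\<Sum>x\<in>S. hscale H (c x) (\<pi> x \<xi>)) \<in> hcarrier H"
    using assms S by (intro hcarrier_sum) auto
  then show "0 \<le> Re (\<Sum>x\<in>S. \<Sum>y\<in>S. cnj (c x) * c y * shift_kernel G (coeff \<xi>) x y)"
    using assms S by (simp add: hinner_combination[symmetric] hinner_nonneg)
qed

section \<open>The action of finitely supported functions and hulls of orbits\<close>

definition combination :: "'h \<Rightarrow> ('g \<Rightarrow> complex) \<Rightarrow> 'h"
  where "combination \<xi> c = (\<Sum>x | c x \<noteq> 0. hscale H (c x) (\<pi> x \<xi>))"

lemma combination_superset:
  assumes "finite S" "{x. c x \<noteq> 0} \<subseteq> S"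
  shows "combination \<xi> c = (\<Sum>x\<in>S. hscale H (c x) (\<pi> x \<xi>))"
  unfolding combination_def using assms by (intro sum.mono_neutral_left) auto

lemma combination_add:
  assumes "c \<in> finsupp N" "d \<in> finsupp N"
  shows "combination \<xi> (c + d) = combination \<xi> c + combination \<xi> d"
proof -
  let ?S = "{x. c x \<noteq> 0} \<union> {x. d x \<noteq> 0}"
  have "finite ?S" using assms by (auto simp: finsupp_def)
  then show ?thesis
    by (subst (1 2 3) combination_superset[of ?S]) (auto simp: scale_left_distrib sum.distrib)
qed

lemma combination_scale: "combination \<xi> (\<lambda>x. a * c x) = hscale H a (combination \<xi> c)"
  by (cases "a = 0") (simp_all add: combination_def scale_sum_right)

lemma combination_point_mass: "combination \<xi> (point_mass x) = \<pi> x \<xi>"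
  unfolding combination_def supp_point_mass by (simp add: point_mass_def)

text \<open>The identity \<open>\<phi>(c\<^sup>* c) =
  \<parallel>\<pi>(c)\<xi>\<parallel>\<^sup>2\<close> of the overview; it turns short vectors in an
  orbit hull into small values of the form.\<close>

lemma hnorm_combination:
  assumes "\<xi> \<in> hcarrier H" "c \<in> finsupp (carrier G)"
  shows "(hnorm H (combination \<xi> c))\<^sup>2 = kform (shift_kernel G (coeff \<xi>)) c"
proof -
  have S: "{x. c x \<noteq> 0} \<subseteq> carrier G" using assms by (simp add: finsupp_def)
  then have "combination \<xi> c \<in> hcarrier H"
    unfolding combination_def using assms by (intro hcarrier_sum) auto
  then have "(hnorm H (combination \<xi> c))\<^sup>2 = Re (hinner H (combination \<xi> c) (combination \<xi> c))"
    by (rule hnorm_power2)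
  then show ?thesis
    unfolding combination_def using hinner_combination[OF assms(1) S] by (simp add: kform_def)
qed

text \<open>The dyadic convex combinations of the orbit. Minimisation of the norm uses midpoints
  alone, and closure under midpoints makes for simple inductions.\<close>

inductive_set orbit_hull :: "'g set \<Rightarrow> 'h \<Rightarrow> 'h set" for N \<xi> where
  orbit: "n \<in> N \<Longrightarrow> \<pi> n \<xi> \<in> orbit_hull N \<xi>"
| midpoint: "x \<in> orbit_hull N \<xi> \<Longrightarrow> y \<in> orbit_hull N \<xi> \<Longrightarrow>
    hscale H (1/2) (x + y) \<in> orbit_hull N \<xi>"

lemma orbit_hull_closed:
  assumes "x \<in> orbit_hull N \<xi>" "\<xi> \<in> hcarrier H" "N \<subseteq> carrier G"
  shows "x \<in> hcarrier H"
  using assms by induction auto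

lemma orbit_hull_rep:
  assumes "x \<in> orbit_hull N \<xi>" "\<xi> \<in> hcarrier H" and N: "subgroup N G" and n: "n \<in> N"
  shows "\<pi> n x \<in> orbit_hull N \<xi>"
  using assms(1)
proof induction
  case (orbit k)
  then have "n \<otimes>\<^bsub>G\<^esub> k \<in> N" "\<pi> n (\<pi> k \<xi>) = \<pi> (n \<otimes>\<^bsub>G\<^esub> k) \<xi>"
    using N n assms(2) by (simp_all add: subgroup.m_closed subgroup.mem_carrier rep_mult)
  then show ?case by (simp add: orbit_hull.orbit)
next
  case (midpoint x y)
  then have "x \<in> hcarrier H" "y \<in> hcarrier H"
    using assms(2) subgroup.subset[OF N] orbit_hull_closed by auto
  then have "\<pi> n (hscale H (1/2) (x + y)) = hscale H (1/2) (\<pi> n x + \<pi> n y)"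
    using subgroup.mem_carrier[OF N n] by (simp add: rep_add rep_scale)
  then show ?case using midpoint orbit_hull.midpoint by simp
qed

text \<open>Of convexity only the total weight 1 is kept: \<open>pairing (\<lambda>x. 1) c\<close>
  is the conjugate of the sum of the values of \<open>c\<close>.\<close>

lemma orbit_hull_combination:
  assumes "x \<in> orbit_hull N \<xi>"
  obtains c where "c \<in> finsupp N" "pairing (\<lambda>x. 1) c = 1" "x = combination \<xi> c"
proof -
  have "\<exists>c\<in>finsupp N. pairing (\<lambda>x. 1) c = 1 \<and> x = combination \<xi> c"
    using assms
  proof induction
    case (orbit n)
    then show ?case by (intro bexI[of _ "point_mass n"]) (auto simp: combination_point_mass)
  next
    case (midpoint x y)
    then obtain c d where cd: "c \<in> finsupp N" "pairing (\<lambda>x. 1) c = 1" "x = combination \<xi> c"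
      "d \<in> finsupp N" "pairing (\<lambda>x. 1) d = 1" "y = combination \<xi> d" by auto
    show ?case
    proof (intro bexI conjI)
      show "(\<lambda>x. 1/2 * (c + d) x) \<in> finsupp N" using cd by (intro finsupp_scale finsupp_add)
      show "pairing (\<lambda>x. 1) (\<lambda>x. 1/2 * (c + d) x) = 1"
        using pairing_add_right[OF cd(1,4), of "\<lambda>x. 1"] cd
        by (subst pairing_scale_right) simp
      show "hscale H (1/2) (x + y) = combination \<xi> (\<lambda>x. 1/2 * (c + d) x)"
        unfolding combination_scale combination_add[OF cd(1,4)] cd(3,6) ..
    qed
  qed
  then show ?thesis using that by blast
qed

text \<open>The vector of minimal norm in the closed convex hull of the \<open>N\<close>-orbit of \<open>\<xi>\<close> is fixed
  by \<open>N\<close>.\<close>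

lemma small_combination:
  assumes N: "subgroup N G" and fixed: "fixed_vectors N = {0}" and \<xi>: "\<xi> \<in> hcarrier H"
    and e: "0 < e"
  obtains c where "c \<in> finsupp N" "pairing (\<lambda>x. 1) c = 1"
    "kform (shift_kernel G (coeff \<xi>)) c < e"
proof -
  have NG: "N \<subseteq> carrier G" using N by (rule subgroup.subset)
  let ?A = "orbit_hull N \<xi>"
  have AH: "x \<in> hcarrier H" if "x \<in> ?A" for x using that \<xi> NG by (rule orbit_hull_closed)
  define Q where "Q = (\<lambda>x. (hnorm H x)\<^sup>2) ` ?A"
  define m where "m = Inf Q"
  have bdd: "bdd_below Q" by (auto simp: Q_def intro!: bdd_belowI[of _ 0])
  have m: "m \<le> (hnorm H x)\<^sup>2" if "x \<in> ?A" for x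
    unfolding m_def using bdd that by (intro cInf_lower) (auto simp: Q_def)
  have ne: "Q \<noteq> {}" using orbit_hull.orbit[OF subgroup.one_closed[OF N]] by (auto simp: Q_def)
  have "\<exists>x\<in>?A. (hnorm H x)\<^sup>2 < m + 1 / Suc n" for n
    using cInf_lessD[OF ne, of "m + 1 / Suc n"] by (auto simp: m_def Q_def)
  then obtain X where X: "\<And>n. X n \<in> ?A" "\<And>n. (hnorm H (X n))\<^sup>2 < m + 1 / Suc n"
    by metis
  have XH: "X n \<in> hcarrier H" for n using X(1) AH by blast
  have lim: "(\<lambda>n. (hnorm H (X n))\<^sup>2) \<longlonglongrightarrow> m"
  proof (rule tendsto_sandwich)
    show "\<forall>\<^sub>F n in sequentially. m \<le> (hnorm H (X n))\<^sup>2" using m X(1) by simp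
    show "\<forall>\<^sub>F n in sequentially. (hnorm H (X n))\<^sup>2 \<le> m + 1 / Suc n"
      using X(2) by (simp add: less_imp_le)
    show "(\<lambda>n. m + 1 / Suc n) \<longlonglongrightarrow> m"
      using tendsto_add[OF tendsto_const LIMSEQ_inverse_real_of_nat, of m]
      by (simp add: inverse_eq_divide)
  qed simp
  obtain x where x: "hlim X x"
    by (rule minimizing_sequence[OF _ lim]) (use XH X(1) m orbit_hull.midpoint in auto)
  have "\<pi> n x = x" if n: "n \<in> N" for n
  proof (rule hlim_unique)
    have nG: "n \<in> carrier G" using n NG by blast
    show "hlim (\<lambda>k. \<pi> n (X k)) (\<pi> n x)" by (rule rep_hlim[OF nG x])
    \<comment> \<open>\<open>\<pi> n (X k)\<close> lies in the hull too and has the same norm as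
      \<open>X k\<close>, so the two summands in \<open>minimizing_diff\<close> coincide.\<close>
    have le: "(hnorm H (\<pi> n (X k) - X k))\<^sup>2 \<le> 4 * ((hnorm H (X k))\<^sup>2 - m)" for k
      using minimizing_diff[of "\<pi> n (X k)" "X k" m] nG XH rep_hnorm
        m[OF orbit_hull.midpoint[OF orbit_hull_rep[OF X(1)[of k] \<xi> N n] X(1)[of k]]] by simp
    have "(\<lambda>k. (hnorm H (\<pi> n (X k) - X k))\<^sup>2) \<longlonglongrightarrow> 0"
    proof (rule tendsto_sandwich[of "\<lambda>n. 0"])
      show "\<forall>\<^sub>F k in sequentially. (hnorm H (\<pi> n (X k) - X k))\<^sup>2 \<le> 4 * ((hnorm H (X k))\<^sup>2 - m)"
        using le by simp
      have "(\<lambda>k. 4 * ((hnorm H (X k))\<^sup>2 - m)) \<longlonglongrightarrow> 4 * (m - m)"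
        by (intro tendsto_intros lim)
      then show "(\<lambda>k. 4 * ((hnorm H (X k))\<^sup>2 - m)) \<longlonglongrightarrow> 0" by simp
    qed simp_all
    then have 1: "(\<lambda>k. hnorm H (\<pi> n (X k) - X k)) \<longlonglongrightarrow> 0" by (rule tendsto_0_power2)
    have xH: "x \<in> hcarrier H" using x by (simp add: hlim_def)
    have "(\<lambda>k. hnorm H (\<pi> n (X k) - x)) \<longlonglongrightarrow> 0"
    proof (rule tendsto_sandwich[of "\<lambda>n. 0"])
      show "\<forall>\<^sub>F k in sequentially. hnorm H (\<pi> n (X k) - x)
          \<le> hnorm H (\<pi> n (X k) - X k) + hnorm H (X k - x)"
      proof (intro always_eventually allI)
        fix k
        show "hnorm H (\<pi> n (X k) - x) \<le> hnorm H (\<pi> n (X k) - X k) + hnorm H (X k - x)"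
          using hnorm_triangle[of "\<pi> n (X k) - X k" "X k - x"] nG XH[of k] xH by simp
      qed
      show "(\<lambda>k. hnorm H (\<pi> n (X k) - X k) + hnorm H (X k - x)) \<longlonglongrightarrow> 0"
        using tendsto_add[OF 1, of "\<lambda>k. hnorm H (X k - x)" 0] x by (simp add: hlim_def)
    qed (use nG XH xH in simp_all)
    then show "hlim (\<lambda>k. \<pi> n (X k)) x" using nG XH xH by (auto simp: hlim_def)
  qed
  then have "x \<in> fixed_vectors N" using x by (simp add: fixed_vectors_def hlim_def)
  \<comment> \<open>The minimal norm is therefore 0, and the members of the minimising sequence
    become arbitrarily short.\<close>
  then have "x = 0" using fixed by simp
  then have "(\<lambda>n. (hnorm H (X n))\<^sup>2) \<longlonglongrightarrow> 0" using tendsto_power[OF hlim_hnorm[OF x], of 2] by simp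
  then have "\<forall>\<^sub>F n in sequentially. (hnorm H (X n))\<^sup>2 < e" using e by (rule order_tendstoD)
  then obtain n where n: "(hnorm H (X n))\<^sup>2 < e" by (auto simp: eventually_sequentially)
  obtain c where c: "c \<in> finsupp N" "pairing (\<lambda>x. 1) c = 1" "X n = combination \<xi> c"
    using orbit_hull_combination[OF X(1)] .
  show ?thesis
    using that[OF c(1,2)] n c hnorm_combination[OF \<xi> finsupp_mono[OF c(1) NG]] by simp
qed

end

section \<open>The Gelfand-Naimark-Segal representation\<close>

text \<open>The compact convex set over which the overview minimises. For normal \<open>R\<close>
  the associated representations are trivial on \<open>R\<close>, by \<open>gns_kernel\<close>.
  Vanishing off \<open>carrier G\<close> keeps the functions bounded on the whole type, as
  compactness requires.\<close>

definition states :: "('g, 'm) monoid_scheme \<Rightarrow> 'g set \<Rightarrow> ('g \<Rightarrow> complex) set"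
  where "states G R = {\<psi>. (\<forall>x. x \<notin> carrier G \<longrightarrow> \<psi> x = 0) \<and> \<psi> \<one>\<^bsub>G\<^esub> = 1 \<and>
    pos_kernel (carrier G) (shift_kernel G \<psi>) \<and> (\<forall>x\<in>R. \<psi> x = 1)}"

lemma shift_kernel_apply: "shift_kernel G \<psi> x y = \<psi> (inv\<^bsub>G\<^esub> x \<otimes>\<^bsub>G\<^esub> y)"
  by (simp add: shift_kernel_def)

lemma pos_kernel_scale:
  assumes "pos_kernel X k" "0 \<le> a"
  shows "pos_kernel X (\<lambda>x y. complex_of_real a * k x y)"
  unfolding pos_kernel_def
proof (intro conjI ballI allI impI)
  fix x y assume "x \<in> X" "y \<in> X"
  then have "k y x = cnj (k x y)" using assms(1) unfolding pos_kernel_def by blast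
  then show "complex_of_real a * k y x = cnj (complex_of_real a * k x y)" by simp
next
  fix S and c :: "'a \<Rightarrow> complex" assume S: "finite S" "S \<subseteq> X"
  then have "0 \<le> Re (\<Sum>x\<in>S. \<Sum>y\<in>S. cnj (c x) * c y * k x y)"
    using assms(1) unfolding pos_kernel_def by blast
  moreover have "(\<Sum>x\<in>S. \<Sum>y\<in>S. cnj (c x) * c y * (complex_of_real a * k x y))
      = complex_of_real a * (\<Sum>x\<in>S. \<Sum>y\<in>S. cnj (c x) * c y * k x y)"
    by (simp add: sum_distrib_left mult_ac)
  ultimately show "0 \<le> Re (\<Sum>x\<in>S. \<Sum>y\<in>S. cnj (c x) * c y * (complex_of_real a * k x y))"
    using assms(2) by simp
qed

text \<open>Used twice: for the initial state coming from the given representation, and for the two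
  parts into which an invariant subspace splits a state.\<close>

lemma (in unitary_representation) normalized_coeff_state:
  assumes \<xi>: "\<xi> \<in> hcarrier H" "\<xi> \<noteq> 0" and R: "R \<subseteq> rep_kernel G H \<pi>"
  shows "(\<lambda>x. complex_of_real (1 / (hnorm H \<xi>)\<^sup>2) * coeff \<xi> x) \<in> states G R"
proof -
  have n: "hnorm H \<xi> \<noteq> 0" using \<xi> hnorm_eq_0_iff by blast
  have *: "coeff \<xi> x = complex_of_real ((hnorm H \<xi>)\<^sup>2)" if "x \<in> carrier G" "\<pi> x \<xi> = \<xi>" for x
    using that \<xi> by (simp add: coeff_def hinner_self_hnorm)
  have "pos_kernel (carrier G)
      (shift_kernel G (\<lambda>x. complex_of_real (1 / (hnorm H \<xi>)\<^sup>2) * coeff \<xi> x))"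
    using pos_kernel_scale[OF pos_kernel_coeff[OF \<xi>(1)], of "1 / (hnorm H \<xi>)\<^sup>2"]
    by (simp add: shift_kernel_def)
  then show ?thesis
    using * n \<xi> R unfolding states_def by (auto simp: rep_one rep_kernel_iff coeff_def subset_iff hinner_self_hnorm)
qed

text \<open>Cauchy-Schwarz for the kernel, applied to the point masses at \<open>x\<close> and at
  the unit, both of seminorm 1.\<close>

lemma (in group) states_norm_le_1:
  assumes "\<psi> \<in> states G R"
  shows "cmod (\<psi> x) \<le> 1"
proof (cases "x \<in> carrier G")
  case True
  interpret positive_kernel "carrier G" "shift_kernel G \<psi>"
    using assms by unfold_locales (simp add: states_def)
  have "kform (shift_kernel G \<psi>) (point_mass y) = 1" if "y \<in> carrier G" for y
    using assms that unfolding kform_def supp_point_mass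
    by (simp add: point_mass_def shift_kernel_apply states_def)
  then have "(cmod (\<psi> x))\<^sup>2 \<le> 1"
    using pairing_ksum_bound[of "point_mass x" "point_mass \<one>\<^bsub>G\<^esub>"] True
    by (simp add: ksum_point_mass shift_kernel_apply)
  then show ?thesis by (simp add: power_le_one_iff abs_square_le_1)
next
  case False
  then show ?thesis using assms by (simp add: states_def)
qed

text \<open>Every defining condition is an equality or weak inequality between continuous functions
  of finitely many coordinates, hence closed for pointwise convergence.\<close>

lemma closed_states: "closed (states G R)"
  unfolding states_def pos_kernel_def shift_kernel_def Ball_def
  by (intro closed_Collect_conj closed_Collect_all closed_Collect_imp closed_Collect_eq
      closed_Collect_le open_Collect_const continuous_intros
      continuous_on_product_coordinates continuous_on_sum continuous_on_cnj)

text \<open>Tychonoff: the states form a closed subset of a product of closed unit discs.\<close>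

lemma (in group) compact_states: "compact (states G R)"
proof -
  have "compactin (product_topology (\<lambda>x. euclidean) UNIV) (\<Pi>\<^sub>E x\<in>UNIV. cball (0::complex) 1)"
    unfolding compactin_PiE by simp
  then have "compact (\<Pi>\<^sub>E x\<in>(UNIV :: 'a set). cball (0::complex) 1)"
    by (simp add: euclidean_product_topology)
  then have "compact ((\<Pi>\<^sub>E x\<in>(UNIV :: 'a set). cball (0::complex) 1) \<inter> states G R)"
    by (rule compact_Int_closed[OF _ closed_states])
  moreover have "(\<Pi>\<^sub>E x\<in>(UNIV :: 'a set). cball (0::complex) 1) \<inter> states G R = states G R"
    using states_norm_le_1 by (auto simp: PiE_iff)
  ultimately show ?thesis by simp
qed

section \<open>Translations on the space of a positive definite function\<close>

locale positive_definite = group G for G :: "('g, 'm) monoid_scheme" +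
  fixes \<psi> :: "'g \<Rightarrow> complex"
  assumes pos_def: "pos_kernel (carrier G) (shift_kernel G \<psi>)"
begin

sublocale positive_kernel "carrier G" "shift_kernel G \<psi>"
  by unfold_locales (rule pos_def)

text \<open>Left translation, applied both to elements of the space and to finitely supported
  functions \<open>c\<close>, where it is left multiplication by \<open>g\<close> in the group
  algebra.\<close>

definition translate :: "'g \<Rightarrow> ('g \<Rightarrow> complex) \<Rightarrow> 'g \<Rightarrow> complex"
  where "translate g f = (\<lambda>x. if x \<in> carrier G then f (inv\<^bsub>G\<^esub> g \<otimes>\<^bsub>G\<^esub> x) else 0)"

lemma cancel_left:
  "g \<in> carrier G \<Longrightarrow> x \<in> carrier G \<Longrightarrow> inv\<^bsub>G\<^esub> g \<otimes>\<^bsub>G\<^esub> (g \<otimes>\<^bsub>G\<^esub> x) = x"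
  "g \<in> carrier G \<Longrightarrow> x \<in> carrier G \<Longrightarrow> g \<otimes>\<^bsub>G\<^esub> (inv\<^bsub>G\<^esub> g \<otimes>\<^bsub>G\<^esub> x) = x"
  by (simp_all add: m_assoc[symmetric])

lemma supp_translate:
  assumes "g \<in> carrier G" "c \<in> finsupp (carrier G)"
  shows "{x. translate g c x \<noteq> 0} = (\<lambda>x. g \<otimes>\<^bsub>G\<^esub> x) ` {x. c x \<noteq> 0}"
proof
  show "{x. translate g c x \<noteq> 0} \<subseteq> (\<lambda>x. g \<otimes>\<^bsub>G\<^esub> x) ` {x. c x \<noteq> 0}"
  proof
    fix x assume "x \<in> {x. translate g c x \<noteq> 0}"
    then have "x \<in> carrier G" "c (inv\<^bsub>G\<^esub> g \<otimes>\<^bsub>G\<^esub> x) \<noteq> 0"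
      by (auto simp: translate_def split: if_splits)
    then show "x \<in> (\<lambda>x. g \<otimes>\<^bsub>G\<^esub> x) ` {x. c x \<noteq> 0}"
      using assms by (intro image_eqI[of _ _ "inv\<^bsub>G\<^esub> g \<otimes>\<^bsub>G\<^esub> x"]) (auto simp: cancel_left)
  qed
  show "(\<lambda>x. g \<otimes>\<^bsub>G\<^esub> x) ` {x. c x \<noteq> 0} \<subseteq> {x. translate g c x \<noteq> 0}"
    using assms by (auto simp: translate_def finsupp_def cancel_left subset_iff)
qed

lemma inj_on_mult_left: "g \<in> carrier G \<Longrightarrow> S \<subseteq> carrier G \<Longrightarrow> inj_on (\<lambda>x. g \<otimes>\<^bsub>G\<^esub> x) S"
  by (rule inj_onI) (auto simp: subset_iff)

lemma finsupp_translate: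
  assumes "g \<in> carrier G" "c \<in> finsupp (carrier G)"
  shows "translate g c \<in> finsupp (carrier G)"
  using supp_translate[OF assms] assms unfolding finsupp_def by auto

lemma pairing_translate:
  assumes g: "g \<in> carrier G" and c: "c \<in> finsupp (carrier G)"
  shows "pairing (translate g f) c = pairing f (translate (inv\<^bsub>G\<^esub> g) c)"
proof -
  have S: "{x. c x \<noteq> 0} \<subseteq> carrier G" using c by (simp add: finsupp_def)
  have ig: "inv\<^bsub>G\<^esub> g \<in> carrier G" using g by simp
  show ?thesis
    unfolding pairing_def supp_translate[OF ig c] sum.reindex[OF inj_on_mult_left[OF ig S]]
    using S g by (intro sum.cong refl) (auto simp: translate_def cancel_left)
qed

text \<open>The kernel is invariant under simultaneous left multiplication of its arguments. Through
  \<open>pairing_translate\<close> this makes translation isometric for the dual norm.\<close>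

lemma kform_translate:
  assumes g: "g \<in> carrier G" and c: "c \<in> finsupp (carrier G)"
  shows "kform (shift_kernel G \<psi>) (translate g c) = kform (shift_kernel G \<psi>) c"
proof -
  have S: "{x. c x \<noteq> 0} \<subseteq> carrier G" using c by (simp add: finsupp_def)
  have t: "translate g c (g \<otimes>\<^bsub>G\<^esub> x) = c x" if "x \<in> carrier G" for x
    using g that by (simp add: translate_def cancel_left)
  have k: "shift_kernel G \<psi> (g \<otimes>\<^bsub>G\<^esub> x) (g \<otimes>\<^bsub>G\<^esub> y) = shift_kernel G \<psi> x y"
    if "x \<in> carrier G" "y \<in> carrier G" for x y
    using g that by (simp add: shift_kernel_apply inv_mult_group m_assoc cancel_left)
  show ?thesis
    unfolding kform_def supp_translate[OF g c] sum.reindex[OF inj_on_mult_left[OF g S]] o_def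
    using S by (intro arg_cong[where f = Re] sum.cong refl) (auto simp: t k subset_iff)
qed

lemma rk_bound_translate:
  assumes "g \<in> carrier G" "rk_bound f C"
  shows "rk_bound (translate g f) C"
  using assms kform_translate[of "inv\<^bsub>G\<^esub> g"] finsupp_translate[of "inv\<^bsub>G\<^esub> g"]
  by (fastforce simp: rk_bound_def pairing_translate)

lemma translate_carrier [simp]:
  assumes "g \<in> carrier G" "f \<in> rk_carrier"
  shows "translate g f \<in> rk_carrier"
  by (rule rk_carrierI[OF _ rk_bound_translate[OF assms(1) rk_bound_rk_sq[OF assms(2)]]])
    (simp add: translate_def)

lemma translate_mult:
  assumes "g \<in> carrier G" "h \<in> carrier G"
  shows "translate (g \<otimes>\<^bsub>G\<^esub> h) f = translate g (translate h f)"
  using assms by (auto simp: translate_def inv_mult_group m_assoc)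

lemma translate_one: "f \<in> rk_carrier \<Longrightarrow> translate \<one>\<^bsub>G\<^esub> f = f"
  by (auto simp: translate_def rk_carrier_outside)

lemma translate_inv:
  assumes "g \<in> carrier G" "f \<in> rk_carrier"
  shows "translate (inv\<^bsub>G\<^esub> g) (translate g f) = f" "translate g (translate (inv\<^bsub>G\<^esub> g) f) = f"
  using assms by (simp_all add: translate_mult[symmetric] translate_one)

lemma rk_sq_translate:
  assumes g: "g \<in> carrier G" and f: "f \<in> rk_carrier"
  shows "rk_sq (translate g f) = rk_sq f"
proof (rule antisym)
  have le: "rk_sq (translate h f') \<le> rk_sq f'" if "h \<in> carrier G" "f' \<in> rk_carrier" for h f'
    using that by (intro rk_sq_le rk_bound_translate rk_bound_rk_sq)
  show "rk_sq (translate g f) \<le> rk_sq f" by (rule le[OF g f])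
  show "rk_sq f \<le> rk_sq (translate g f)"
    using le[of "inv\<^bsub>G\<^esub> g" "translate g f"] g f by (simp add: translate_inv)
qed

text \<open>Restricted because the elements of \<open>unitary_group\<close> are extensional.\<close>

definition gns :: "'g \<Rightarrow> ('g \<Rightarrow> complex) \<Rightarrow> 'g \<Rightarrow> complex"
  where "gns g = restrict (translate g) rk_carrier"

lemma unitary_rep_gns: "unitary_rep G rk_space gns"
proof -
  have iso: "unitary_iso rk_space rk_space (gns g)" if g: "g \<in> carrier G" for g
  proof (rule unitary_isoI)
    show "bij_betw (gns g) (hcarrier rk_space) (hcarrier rk_space)"
      using g by (intro bij_betw_byWitness[of _ "translate (inv\<^bsub>G\<^esub> g)"])
        (auto simp: gns_def translate_inv)
    fix f h and a :: complex assume "f \<in> hcarrier rk_space"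
    then show "gns g (hscale rk_space a f) = hscale rk_space a (gns g f)"
      by (auto simp: gns_def translate_def)
    show "hnorm rk_space (gns g f) = hnorm rk_space f"
      using g \<open>f \<in> hcarrier rk_space\<close> by (simp add: gns_def hnorm_rk_space rk_sq_translate)
    assume "h \<in> hcarrier rk_space"
    then show "gns g (f + h) = gns g f + gns g h"
      using \<open>f \<in> hcarrier rk_space\<close> by (auto simp: gns_def translate_def)
  qed (rule pre_hilbert_space_rk_space)+
  then have mem: "gns g \<in> carrier (unitary_group rk_space)" if "g \<in> carrier G" for g
    using that by (simp add: unitary_group_def gns_def)
  have "gns (g \<otimes>\<^bsub>G\<^esub> h) = gns g \<otimes>\<^bsub>unitary_group rk_space\<^esub> gns h"
    if "g \<in> carrier G" "h \<in> carrier G" for g h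
    unfolding mult_unitary_group[OF mem[OF that(1)] mem[OF that(2)]] using that
    by (auto simp: gns_def compose_def restrict_def translate_mult)
  then show ?thesis
    using mem hilbert_space_rk_space by (auto simp: unitary_rep_def hom_def)
qed

sublocale GNS: unitary_representation G rk_space gns
  by unfold_locales (rule unitary_rep_gns)

section \<open>The cyclic vector and the kernel of the representation\<close>

definition cyclic :: "'g \<Rightarrow> complex"
  where "cyclic = ksum (point_mass \<one>\<^bsub>G\<^esub>)"

lemma cyclic_carrier [simp]: "cyclic \<in> rk_carrier"
  by (simp add: cyclic_def)

text \<open>The orbit of the cyclic vector consists of the kernel sections, whose combinations are
  dense.\<close>

lemma gns_cyclic: "g \<in> carrier G \<Longrightarrow> gns g cyclic = ksum (point_mass g)"
  using ksum_carrier[of "point_mass \<one>\<^bsub>G\<^esub>"]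
  by (auto simp: gns_def cyclic_def ksum_point_mass translate_def shift_kernel_apply inv_mult_group)

text \<open>The reproducing property. In particular a vector orthogonal to the orbit of
  \<open>cyclic\<close> vanishes on \<open>carrier G\<close>, hence is 0.\<close>

lemma rk_inner_gns_cyclic: "f \<in> rk_carrier \<Longrightarrow> g \<in> carrier G \<Longrightarrow> rk_inner f (gns g cyclic) = f g"
  by (simp add: gns_cyclic rk_inner_ksum)

lemma gns_cyclic_one: "g \<in> carrier G \<Longrightarrow> gns g cyclic \<one>\<^bsub>G\<^esub> = \<psi> g"
  by (simp add: gns_cyclic ksum_point_mass shift_kernel_apply)

lemma cyclic_apply: "g \<in> carrier G \<Longrightarrow> cyclic g = \<psi> (inv\<^bsub>G\<^esub> g)"
  by (simp add: cyclic_def ksum_point_mass shift_kernel_apply)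

text \<open>Evaluate \<open>gns g cyclic = cyclic\<close> at the unit.\<close>

lemma gns_kernel_state:
  assumes "g \<in> rep_kernel G rk_space gns"
  shows "\<psi> g = \<psi> \<one>\<^bsub>G\<^esub>"
  using assms gns_cyclic_one[of g] cyclic_apply[of "\<one>\<^bsub>G\<^esub>"] by (simp add: GNS.rep_kernel_iff)

text \<open>If \<open>x\<close> and \<open>y\<close> lie in the same coset of \<open>R\<close>, the
  form at the difference of their point masses is \<open>1 - 1 - 1 + 1 = 0\<close>, so every element
  of the space takes equal values at \<open>x\<close> and \<open>y\<close>.\<close>

lemma gns_kernel:
  assumes R: "R \<lhd> G" and \<psi>: "\<psi> \<in> states G R"
  shows "R \<subseteq> rep_kernel G rk_space gns"
proof
  fix n assume n: "n \<in> R"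
  have RG: "x \<in> carrier G" if "x \<in> R" for x
    using R that subgroup.mem_carrier normal_imp_subgroup by metis
  have nG: "n \<in> carrier G" by (rule RG[OF n])
  have "gns n f = f" if f: "f \<in> rk_carrier" for f
  proof
    fix x
    show "gns n f x = f x"
    proof (cases "x \<in> carrier G")
      case x: True
      define y where "y = inv\<^bsub>G\<^esub> n \<otimes>\<^bsub>G\<^esub> x"
      have y: "y \<in> carrier G" using x nG by (simp add: y_def)
      have "inv\<^bsub>G\<^esub> n \<in> R"
        using R n normal_imp_subgroup subgroup.m_inv_closed by metis
      then have xy: "inv\<^bsub>G\<^esub> x \<otimes>\<^bsub>G\<^esub> y \<in> R"
        using normal.inv_op_closed1[OF R x] nG x by (fastforce simp: y_def m_assoc)
      then have "inv\<^bsub>G\<^esub> (inv\<^bsub>G\<^esub> x \<otimes>\<^bsub>G\<^esub> y) \<in> R"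
        using R normal_imp_subgroup subgroup.m_inv_closed by metis
      then have yx: "inv\<^bsub>G\<^esub> y \<otimes>\<^bsub>G\<^esub> x \<in> R" using x y by (simp add: inv_mult_group)
      have "pairing (ksum (point_mass x - point_mass y)) (point_mass x - point_mass y) = 0"
        using x y xy yx \<psi>
        by (simp add: ksum_diff pairing_diff_left pairing_diff_right[of _ "carrier G"]
            ksum_point_mass shift_kernel_apply states_def)
      then have "kform (shift_kernel G \<psi>) (point_mass x - point_mass y) = 0"
        using x y by (simp add: kform_eq)
      then have "pairing f (point_mass x - point_mass y) = 0"
        using pairing_bound[OF f, of "point_mass x - point_mass y"] x y by simp
      then have "f x = f y" using x y by (simp add: pairing_diff_right[of _ "carrier G"])
      then show ?thesis using f x by (simp add: gns_def translate_def y_def)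
    next
      case False
      then show ?thesis using f by (simp add: gns_def translate_def rk_carrier_outside)
    qed
  qed
  then show "n \<in> rep_kernel G rk_space gns" using nG by (simp add: GNS.rep_kernel_iff)
qed

text \<open>Splitting \<open>cyclic = u + v\<close> along an invariant \<open>W\<close> writes
  \<psi> as a convex combination of normalised coefficients of \<open>u\<close> and
  \<open>v\<close>. Extremality makes these equal, which forces \<open>u\<close> to be a multiple of
  \<open>cyclic\<close> and hence \<open>cyclic\<close> to lie in \<open>W\<close>.\<close>

theorem gns_irreducible:
  assumes R: "R \<lhd> G" and \<psi>: "\<psi> \<in> states G R"
    and extreme: "\<And>\<psi>1 \<psi>2 t. \<psi>1 \<in> states G R \<Longrightarrow> \<psi>2 \<in> states G R \<Longrightarrow> 0 < t \<Longrightarrow> t < 1 \<Longrightarrow>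
      \<psi> = (\<lambda>x. of_real t * \<psi>1 x + of_real (1 - t) * \<psi>2 x) \<Longrightarrow> \<psi>1 = \<psi>2"
  shows "irreducible_rep G rk_space gns"
  unfolding irreducible_rep_def
proof (intro conjI allI impI)
  show "unitary_rep G rk_space gns" by (rule unitary_rep_gns)
  have one: "\<psi> \<one>\<^bsub>G\<^esub> = 1" using \<psi> by (simp add: states_def)
  then have "cyclic \<noteq> 0" using cyclic_apply[of "\<one>\<^bsub>G\<^esub>"] by auto
  then show "hcarrier rk_space \<noteq> {0}" using cyclic_carrier by (metis rk_space_simps(1) singletonD)
  fix W assume W: "invariant_closed_subspace G rk_space gns W"
  let ?W' = "GNS.horth W"
  have Wc: "closed_subspace rk_space W" and Winv: "\<And>g x. g \<in> carrier G \<Longrightarrow> x \<in> W \<Longrightarrow> gns g x \<in> W"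
    using W by (auto simp: invariant_closed_subspace_def)
  have W'inv: "\<And>g x. g \<in> carrier G \<Longrightarrow> x \<in> ?W' \<Longrightarrow> gns g x \<in> ?W'"
    using GNS.invariant_horth[OF W] by (auto simp: invariant_closed_subspace_def)
  have WH: "x \<in> rk_carrier" if "x \<in> W" for x using GNS.closed_subspaceD(1)[OF Wc] that by auto
  have W'H: "x \<in> rk_carrier" if "x \<in> ?W'" for x using that by (simp add: GNS.horth_def)
  have orth: "rk_inner x y = 0" "rk_inner y x = 0" if "x \<in> W" "y \<in> ?W'" for x y
    using that GNS.horth_swap[of y W x] GNS.closed_subspaceD(1)[OF Wc]
    by (auto simp: GNS.horth_def)
  have zero: "f = 0" if f: "f \<in> rk_carrier" "\<And>g. g \<in> carrier G \<Longrightarrow> f g = 0" for f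
  proof
    fix g
    show "f g = 0 g" using f rk_carrier_outside[OF f(1), of g] by (cases "g \<in> carrier G") auto
  qed
  \<comment> \<open>Cyclicity: a component orthogonal to \<open>W\<close> is orthogonal to the orbit
    of \<open>cyclic\<close>, so it is 0.\<close>
  have W_full: "W = hcarrier rk_space" if e: "cyclic \<in> W"
  proof -
    have "x \<in> W" if x: "x \<in> rk_carrier" for x
    proof -
      obtain u v where uv: "u \<in> W" "v \<in> ?W'" "x = u + v"
        using GNS.orthogonal_decomposition[OF Wc, of x] x by auto
      have "v g = 0" if "g \<in> carrier G" for g
        using orth(2)[OF Winv[OF that e] uv(2)] rk_inner_gns_cyclic[OF W'H[OF uv(2)] that] by simp
      then have "v = 0" using zero W'H uv(2) by blast
      then show ?thesis using uv by simp
    qed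
    then show ?thesis using WH by auto
  qed
  obtain u v where u: "u \<in> W" and v: "v \<in> ?W'" and uv: "cyclic = u + v"
    using GNS.orthogonal_decomposition[OF Wc, of cyclic] by auto
  note uH = WH[OF u] and vH = W'H[OF v]
  show "W = {0} \<or> W = hcarrier rk_space"
  proof (cases "u = 0")
    case True
    \<comment> \<open>Now \<open>W\<close> is orthogonal to the whole orbit of
      \<open>cyclic\<close>, because the complement of \<open>W\<close> is invariant.\<close>
    then have e: "cyclic \<in> ?W'" using uv v by simp
    have "f = 0" if f: "f \<in> W" for f
    proof (rule zero[OF WH[OF f]])
      fix g assume g: "g \<in> carrier G"
      show "f g = 0"
        using orth(1)[OF f W'inv[OF g e]] rk_inner_gns_cyclic[OF WH[OF f] g] by simp
    qed
    moreover have "0 \<in> W" using u True by simp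
    ultimately show ?thesis by blast
  next
    case u0: False
    have "cyclic \<in> W"
    proof (cases "v = 0")
      case True
      then show ?thesis using uv u by simp
    next
      case v0: False
      define t where "t = (hnorm rk_space u)\<^sup>2"
      have n0: "hnorm rk_space u \<noteq> 0" "hnorm rk_space v \<noteq> 0"
        using u0 v0 uH vH GNS.hnorm_eq_0_iff by simp_all
      \<comment> \<open>The cross terms vanish, as \<open>W\<close> and its complement are both
        invariant.\<close>
      have split: "\<psi> x = GNS.coeff u x + GNS.coeff v x" for x
      proof (cases "x \<in> carrier G")
        case x: True
        have "\<psi> x = rk_inner (gns x cyclic) cyclic"
          using rk_inner_gns_cyclic[of "gns x cyclic" "\<one>\<^bsub>G\<^esub>"] gns_cyclic_one[OF x] x
            GNS.rep_closed[OF x, of cyclic] GNS.rep_one[of cyclic] by simp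
        also have "\<dots> = rk_inner (gns x u + gns x v) (u + v)"
          using GNS.rep_add[OF x, of u v] uH vH uv by simp
        also have "\<dots> = rk_inner (gns x u) u + rk_inner (gns x v) v"
          using GNS.hinner_add GNS.hinner_add_right GNS.rep_closed[OF x] uH vH
            orth(1)[OF Winv[OF x u] v] orth(2)[OF u W'inv[OF x v]] by simp
        finally show ?thesis using x by (simp add: GNS.coeff_def)
      next
        case False
        then show ?thesis using \<psi> by (simp add: GNS.coeff_def states_def)
      qed
      have sum1: "t + (hnorm rk_space v)\<^sup>2 = 1"
      proof -
        have "complex_of_real (t + (hnorm rk_space v)\<^sup>2) = 1"
          using split[of "\<one>\<^bsub>G\<^esub>"] one uH vH GNS.hinner_self_hnorm[of u]
            GNS.hinner_self_hnorm[of v] GNS.rep_one[of u] GNS.rep_one[of v]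
          by (simp add: GNS.coeff_def t_def)
        then show ?thesis using of_real_eq_1_iff by blast
      qed
      have t: "0 < t" "t < 1" using n0 sum1 by (auto simp: t_def zero_less_power2 sum1[symmetric])
      define c1 where "c1 = (\<lambda>x. complex_of_real (1 / t) * GNS.coeff u x)"
      define c2 where "c2 = (\<lambda>x. complex_of_real (1 / (1 - t)) * GNS.coeff v x)"
      \<comment> \<open>\<open>R\<close> acts trivially by \<open>gns_kernel\<close>, so the
        normalised coefficients take the value 1 on \<open>R\<close>.\<close>
      have "c1 \<in> states G R"
        unfolding c1_def t_def using GNS.normalized_coeff_state[OF _ u0 gns_kernel[OF R \<psi>]] uH by simp
      moreover have "1 - t = (hnorm rk_space v)\<^sup>2" using sum1 by simp
      then have "c2 \<in> states G R"
        unfolding c2_def using GNS.normalized_coeff_state[OF _ v0 gns_kernel[OF R \<psi>]] vH by simp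
      moreover have "\<psi> = (\<lambda>x. of_real t * c1 x + of_real (1 - t) * c2 x)"
        using split t by (auto simp: c1_def c2_def simp flip: of_real_diff)
      ultimately have "c1 = c2" and comb: "\<psi> = (\<lambda>x. of_real t * c1 x + of_real (1 - t) * c2 x)"
        using extreme t by blast+
      then have eq_c1: "\<psi> = c1" by (auto simp: algebra_simps)
      have coeff_u: "GNS.coeff u x = t * \<psi> x" for x
        using fun_cong[OF eq_c1, of x] t by (simp add: c1_def)
      \<comment> \<open>Test \<open>u\<close> against the orbit of \<open>cyclic\<close>, move the
        group element to the left, and replace \<open>cyclic\<close> by \<open>u\<close>; the
        difference \<open>v\<close> contributes nothing, being orthogonal to
        \<open>W\<close>.\<close>
      have "u = (\<lambda>x. t * cyclic x)"
      proof
        fix x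
        show "u x = t * cyclic x"
        proof (cases "x \<in> carrier G")
          case x: True
          then have ix: "inv\<^bsub>G\<^esub> x \<in> carrier G" by simp
          have "u x = rk_inner u (gns x cyclic)" using rk_inner_gns_cyclic[OF uH x] by simp
          also have "\<dots> = rk_inner (gns (inv\<^bsub>G\<^esub> x) u) cyclic"
            using GNS.rep_adjoint[OF ix, of u cyclic] uH x by simp
          also have "\<dots> = rk_inner (gns (inv\<^bsub>G\<^esub> x) u) u"
            using GNS.hinner_add_right[of u v "gns (inv\<^bsub>G\<^esub> x) u"] GNS.rep_closed[OF ix, of u]
              uH vH orth(1)[OF Winv[OF ix u] v] by (simp add: uv)
          also have "\<dots> = GNS.coeff u (inv\<^bsub>G\<^esub> x)" using ix by (simp add: GNS.coeff_def)
          also have "\<dots> = t * cyclic x" using x by (simp add: coeff_u cyclic_apply)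
          finally show ?thesis .
        next
          case False
          then show ?thesis using uH by (simp add: rk_carrier_outside)
        qed
      qed
      then have "cyclic = hscale rk_space (1 / t) u" using t by simp
      then show ?thesis
        using GNS.subspace_scale[OF GNS.closed_subspaceD(2)[OF Wc] u] by metis
    qed
    then show ?thesis using W_full by blast
  qed
qed

end

section \<open>The existence theorem\<close>

lemma (in group) normal_Inter:
  assumes "\<A> \<noteq> {}" "\<And>N. N \<in> \<A> \<Longrightarrow> N \<lhd> G"
  shows "\<Inter>\<A> \<lhd> G"
  using assms subgroups_Inter[of \<A>] by (fastforce simp: normal_inv_iff)

text \<open>A function equal to 1 on \<open>N\<close> has constant kernel 1 there. For total weight
  1 the form thus has the value 1, which a small value at \<psi> rules out.\<close>

lemma kform_shift_kernel_const:
  assumes N: "subgroup N G" and c: "c \<in> finsupp N" and \<psi>: "\<And>x. x \<in> N \<Longrightarrow> \<psi> x = 1"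
  shows "kform (shift_kernel G \<psi>) c = (cmod (pairing (\<lambda>x. 1) c))\<^sup>2"
proof -
  let ?S = "{x. c x \<noteq> 0}"
  have "shift_kernel G \<psi> x y = 1" if "x \<in> ?S" "y \<in> ?S" for x y
    unfolding shift_kernel_def using c that
    by (intro \<psi> subgroup.m_closed[OF N] subgroup.m_inv_closed[OF N]) (auto simp: finsupp_def)
  then have "(\<Sum>x\<in>?S. \<Sum>y\<in>?S. cnj (c x) * c y * shift_kernel G \<psi> x y)
      = (\<Sum>x\<in>?S. \<Sum>y\<in>?S. cnj (c x) * c y)"
    by (intro sum.cong refl) simp
  also have "\<dots> = pairing (\<lambda>x. 1) c * cnj (pairing (\<lambda>x. 1) c)"
    by (simp add: pairing_def sum_product)
  finally show ?thesis by (simp add: kform_def complex_norm_square[symmetric] flip: of_real_power)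
qed

lemma continuous_on_kform_shift_kernel: "continuous_on K (\<lambda>\<psi>. kform (shift_kernel G \<psi>) c)"
  unfolding kform_def shift_kernel_def
  by (intro continuous_on_Re continuous_on_sum continuous_on_mult continuous_on_const
      continuous_on_subset[OF continuous_on_product_coordinates]) auto

lemma kform_shift_kernel_affine:
  "kform (shift_kernel G (\<lambda>x. of_real s * \<psi>1 x + of_real t * \<psi>2 x)) c
    = s * kform (shift_kernel G \<psi>1) c + t * kform (shift_kernel G \<psi>2) c"
proof -
  let ?S = "{x. c x \<noteq> 0}"
  have "(\<Sum>x\<in>?S. \<Sum>y\<in>?S. cnj (c x) * c y *
        shift_kernel G (\<lambda>x. of_real s * \<psi>1 x + of_real t * \<psi>2 x) x y)
    = of_real s * (\<Sum>x\<in>?S. \<Sum>y\<in>?S. cnj (c x) * c y * shift_kernel G \<psi>1 x y)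
    + of_real t * (\<Sum>x\<in>?S. \<Sum>y\<in>?S. cnj (c x) * c y * shift_kernel G \<psi>2 x y)"
    by (simp add: shift_kernel_def sum_distrib_left sum.distrib[symmetric] algebra_simps)
  then show ?thesis by (simp add: kform_def)
qed

text \<open>The exponents start at 2 so that the total stays at most 1/2, strictly below the value 1
  to be excluded.\<close>

lemma sum_half_powers_le: "(\<Sum>i<n. (1/2 :: real) ^ (i + 2)) \<le> 1/2"
proof -
  have "(\<Sum>i<n. (1/2 :: real) ^ (i + 2)) = 1/2 - (1/2) ^ (n + 1)"
    by (induction n) simp_all
  then show ?thesis by simp
qed

theorem proposition1p14:
  fixes G :: "('g, 'm) monoid_scheme"
    and H :: "('h::ab_group_add) hilbert"
    and \<pi> :: "'g \<Rightarrow> 'h \<Rightarrow> 'h"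
  assumes "group G" and "countable (carrier G)"
    and "factor_rep G H \<pi>"
  shows "\<exists>(K :: ('g \<Rightarrow> complex) hilbert) (\<sigma> :: 'g \<Rightarrow> ('g \<Rightarrow> complex) \<Rightarrow> ('g \<Rightarrow> complex)).
    irreducible_rep G K \<sigma> \<and> rep_kernel G K \<sigma> = rep_kernel G H \<pi>"
proof -
  interpret group G by fact
  interpret U: unitary_representation G H \<pi>
    using assms by unfold_locales (simp add: factor_rep_def)
  define R where "R = rep_kernel G H \<pi>"
  have R: "R \<lhd> G" unfolding R_def by (rule U.rep_kernel_normal)
  define X where "X = carrier G - R"
  \<comment> \<open>The normal closure of \<open>g\<close>. For \<open>g \<in> carrier G\<close> the
    intersected family contains \<open>carrier G\<close>, so it is nonempty.\<close>
  define N where "N = (\<lambda>g. \<Inter>{M. M \<lhd> G \<and> g \<in> M})"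
  have carrier_normal: "carrier G \<lhd> G" by (simp add: normal_inv_iff subgroup_self)
  have N: "N g \<lhd> G" if "g \<in> carrier G" for g
    unfolding N_def using that carrier_normal by (intro normal_Inter) auto
  have gN: "g \<in> N g" for g by (simp add: N_def)
  have NG: "N g \<subseteq> carrier G" if "g \<in> carrier G" for g
    using carrier_normal that by (auto simp: N_def)
  \<comment> \<open>One state \<phi> serves all \<open>g\<close> outside \<open>R\<close> and all
    tolerances; only \<open>c\<close> depends on them.\<close>
  have "\<exists>\<phi>\<in>states G R. \<forall>g\<in>X. \<forall>e>0. \<exists>c\<in>finsupp (N g). pairing (\<lambda>x. 1) c = 1 \<and>
      kform (shift_kernel G \<phi>) c < e"
  proof (cases "hcarrier H = {0}")
    \<comment> \<open>The zero representation has kernel \<open>carrier G\<close>, so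
      \<open>X\<close> is empty and the trivial character \<open>indicator (carrier G)\<close>
      serves as the state.\<close>
    case True
    have "X = {}"
      using True U.rep_closed by (auto simp: X_def R_def U.rep_kernel_iff)
    have one: "shift_kernel G (indicator (carrier G)) x y = 1"
      if "x \<in> carrier G" "y \<in> carrier G" for x y
      using that by (simp add: shift_kernel_def)
    have "pos_kernel (carrier G) (shift_kernel G (indicator (carrier G)))"
      unfolding pos_kernel_def
    proof (intro conjI ballI allI impI)
      fix S and c :: "'g \<Rightarrow> complex" assume S: "finite S" "S \<subseteq> carrier G"
      have "(\<Sum>x\<in>S. \<Sum>y\<in>S. cnj (c x) * c y * shift_kernel G (indicator (carrier G)) x y)
          = (\<Sum>x\<in>S. \<Sum>y\<in>S. cnj (c x) * c y)"
        using S by (intro sum.cong refl) (simp add: one subset_iff)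
      also have "\<dots> = cnj (\<Sum>x\<in>S. c x) * (\<Sum>x\<in>S. c x)"
        by (simp add: sum_product)
      also have "\<dots> = of_real ((cmod (\<Sum>x\<in>S. c x))\<^sup>2)"
        by (simp only: complex_norm_square mult.commute)
      finally show "0 \<le> Re (\<Sum>x\<in>S. \<Sum>y\<in>S. cnj (c x) * c y * shift_kernel G (indicator (carrier G)) x y)"
        by simp
    qed (simp add: one)
    then have "indicator (carrier G) \<in> states G R"
      by (auto simp: states_def R_def kernel_def)
    then show ?thesis using \<open>X = {}\<close> by blast
  next
    case False
    then obtain \<eta> where \<eta>: "\<eta> \<in> hcarrier H" "\<eta> \<noteq> 0"
      using U.hcarrier_0 by blast
    define \<xi> where "\<xi> = hscale H (of_real (1 / hnorm H \<eta>)) \<eta>"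
    have \<eta>0: "hnorm H \<eta> \<noteq> 0" using \<eta> U.hnorm_eq_0_iff by simp
    have \<xi>: "\<xi> \<in> hcarrier H" "hnorm H \<xi> = 1"
      using \<eta> \<eta>0 U.hnorm_nonneg[of \<eta>] unfolding \<xi>_def by (simp_all add: U.hnorm_scale norm_divide)
    then have "\<xi> \<noteq> 0" by auto
    from U.normalized_coeff_state[OF \<xi>(1) this, of R] have "U.coeff \<xi> \<in> states G R"
      using \<xi>(2) by (simp add: R_def)
    moreover have "\<exists>c\<in>finsupp (N g). pairing (\<lambda>x. 1) c = 1 \<and> kform (shift_kernel G (U.coeff \<xi>)) c < e"
      if g: "g \<in> X" and e: "0 < e" for g e
    proof -
      have gG: "g \<in> carrier G" using g by (simp add: X_def)
      \<comment> \<open>Witnessed by \<open>g\<close> itself; hence the factor property leaves no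
        nonzero vector fixed by \<open>N g\<close>.\<close>
      have "\<not> N g \<subseteq> rep_kernel G H \<pi>" using gN g by (auto simp: X_def R_def)
      then have "U.fixed_vectors (N g) = {0}"
        by (rule U.factor_rep_fixed_vectors[OF assms(3) N[OF gG]])
      then show ?thesis
        using U.small_combination[OF normal_imp_subgroup[OF N[OF gG]] _ \<xi>(1) e] by metis
    qed
    ultimately show ?thesis by blast
  qed
  then obtain \<phi> where \<phi>: "\<phi> \<in> states G R"
    and small: "\<And>g e. g \<in> X \<Longrightarrow> 0 < e \<Longrightarrow> \<exists>c\<in>finsupp (N g). pairing (\<lambda>x. 1) c = 1 \<and>
      kform (shift_kernel G \<phi>) c < e" by blast
  have "\<exists>c. c \<in> finsupp (carrier G) \<and> kform (shift_kernel G \<phi>) c \<le> (1/2) ^ (n + 2) \<and>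
      (X \<noteq> {} \<longrightarrow> c \<in> finsupp (N (from_nat_into X n)) \<and> pairing (\<lambda>x. 1) c = 1)" for n :: nat
  proof (cases "X = {}")
    case True
    \<comment> \<open>With no \<open>g\<close> to exclude, the zero function is a
      placeholder.\<close>
    then show ?thesis by (intro exI[of _ "\<lambda>x. 0"]) (simp add: kform_def)
  next
    case False
    then have g: "from_nat_into X n \<in> X" by (rule from_nat_into)
    then have "finsupp (N (from_nat_into X n)) \<subseteq> finsupp (carrier G)"
      using NG[of "from_nat_into X n"] by (auto simp: X_def intro: finsupp_mono)
    then show ?thesis using small[OF g, of "(1/2) ^ (n + 2)"] by (auto intro: less_imp_le)
  qed
  then obtain c where c: "\<And>n. c n \<in> finsupp (carrier G)"
    and c_small: "\<And>n. kform (shift_kernel G \<phi>) (c n) \<le> (1/2) ^ (n + 2)"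
    and c_N: "\<And>n. X \<noteq> {} \<Longrightarrow> c n \<in> finsupp (N (from_nat_into X n)) \<and> pairing (\<lambda>x. 1) (c n) = 1"
    by metis
  \<comment> \<open>The series of the forms at \<phi> has partial sums at most 1/2. The extreme
    state found below this bound inherits it for each single term.\<close>
  obtain \<psi> where \<psi>: "\<psi> \<in> states G R"
    and \<psi>_small: "\<And>i. kform (shift_kernel G \<psi>) (c i) \<le> 1/2"
    and extreme: "\<And>\<psi>1 \<psi>2 t. \<psi>1 \<in> states G R \<Longrightarrow> \<psi>2 \<in> states G R \<Longrightarrow> 0 < t \<Longrightarrow> t < 1 \<Longrightarrow>
      \<psi> = (\<lambda>x. of_real t * \<psi>1 x + of_real (1 - t) * \<psi>2 x) \<Longrightarrow> \<psi>1 = \<psi>2"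
  proof (rule extreme_point_below[OF compact_states closed_states assms(2), where s = "1/2"
        and F = "\<lambda>i \<psi>. kform (shift_kernel G \<psi>) (c i)"])
    show "\<phi> \<in> states G R" by (rule \<phi>)
    show "(\<Sum>i<n. kform (shift_kernel G \<phi>) (c i)) \<le> 1/2" for n
      using sum_mono[of "{..<n}", OF c_small] sum_half_powers_le[of n] by (rule order_trans)
    show "0 \<le> kform (shift_kernel G \<theta>) (c i)" if "\<theta> \<in> states G R" for i \<theta>
    proof -
      interpret positive_kernel "carrier G" "shift_kernel G \<theta>"
        using that by unfold_locales (simp add: states_def)
      show ?thesis by (rule kform_nonneg[OF c])
    qed
    show "cmod (\<theta> x) \<le> 1" if "\<theta> \<in> states G R" for \<theta> x
      using that by (rule states_norm_le_1)
    show "\<theta> x = 0" if "\<theta> \<in> states G R" "x \<notin> carrier G" for \<theta> x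
      using that by (simp add: states_def)
  qed (rule continuous_on_kform_shift_kernel kform_shift_kernel_affine that; assumption)+
  interpret P: positive_definite G \<psi>
    using \<psi> by unfold_locales (simp add: states_def)
  have irr: "irreducible_rep G P.rk_space P.gns"
    by (rule P.gns_irreducible[OF R \<psi> extreme])
  have "g \<in> R" if g: "g \<in> rep_kernel G P.rk_space P.gns" for g
  proof (rule ccontr)
    assume "g \<notin> R"
    moreover have gG: "g \<in> carrier G" using g by (simp add: kernel_def)
    ultimately have gX: "g \<in> X" by (simp add: X_def)
    have "countable X" using assms(2) by (simp add: X_def)
    then obtain n where n: "g = from_nat_into X n" using gX from_nat_into_surj by metis
    have cn: "c n \<in> finsupp (N g)" "pairing (\<lambda>x. 1) (c n) = 1" using c_N[of n] gX n by auto
    \<comment> \<open>The kernel is a normal subgroup containing \<open>g\<close>, so it contains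
      the normal closure. Then \<psi> is 1 on \<open>N g\<close>, and the form at \<open>c n\<close>
      would be 1 instead of at most 1/2.\<close>
    have "N g \<subseteq> rep_kernel G P.rk_space P.gns"
      using g P.GNS.rep_kernel_normal by (auto simp: N_def)
    then have "\<psi> x = 1" if "x \<in> N g" for x
      using P.gns_kernel_state[of x] that \<psi> by (auto simp: states_def)
    then have "kform (shift_kernel G \<psi>) (c n) = 1"
      using kform_shift_kernel_const[OF normal_imp_subgroup[OF N[OF gG]] cn(1)] cn(2) by simp
    then show False using \<psi>_small[of n] by simp
  qed
  then have "rep_kernel G P.rk_space P.gns = R"
    using P.gns_kernel[OF R \<psi>] by blast
  then show ?thesis using irr R_def by blast
qed

end
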